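(* Let $n\ge4$ be even, let $F$ be any field, and let $\beta\in F\setminus\{0\}$. Let $L$ be the $(n+1)$-dimensional $n$-Lie algebra over $F$ with basis $e_1,\dots,e_{n+1}$ and structure constants $$[e_2,\dots,e_{n+1}]=e_1+\beta e_2,\qquad [e_1,e_3,\dots,e_{n+1}]=e_2$$ (brackets of basis elements not determined by these and the alternating property are zero). In $F\langle X\rangle$, $X=\{x_1,\dots,x_{n+1}\}$, let $$G_1=(-1)^{\lfloor n/2\rfloor}\big(\mathrm{alt}(x_2,\dots,x_{n+1})-(x_1+\beta x_2)\big),\qquad G_2=(-1)^{\lfloor n/2\rfloor}\big(\mathrm{alt}(x_1,x_3,\dots,x_{n+1})-x_2\big),$$ $$G_i=(-1)^{\lfloor n/2\rfloor}\mathrm{alt}(x_1,\dots,\widehat{x}_i,\dots,x_{n+1})\quad(3\le i\le n+1),$$ let $N=x_2x_1-x_1x_2$, and for $3\le i\le n+1$ let $$K_i=-(-1)^{\lfloor n/2\rfloor}\sum_{\sigma\in V_n^{(i)}}\epsilon(\sigma)\,x_{\sigma(1)}x_{\sigma(2)}\cdots x_{\sigma(n)},$$ where $V_n^{(i)}$ is the set of permutations of $\{1,\dots,\widehat{i},\dots,n+1\}$ in which $1$ and $2$ do not appear consecutively. Then $$\{G_1,G_2,K_3,\dots,K_{n+1},N\}$$ is a Gröbner basis (with respect to the degree-lexicographical order) of the ideal $I=\langle G_1,\dots,G_{n+1}\rangle\subseteq F\langle X\rangle$.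
   Context: An $n$-Lie algebra is a vector space with a multilinear alternating operation $[z_1,\dots,z_n]$ satisfying $[[z_1,\dots,z_n],w_2,\dots,w_n]=\sum_{i=1}^n[z_1,\dots,[z_i,w_2,\dots,w_n],\dots,z_n]$. The elements $G_i$ are the generators of the ideal defining the universal associative envelope $U(L)=F\langle X\rangle/I$. A hat means the entry is omitted. $\mathrm{alt}(z_1,\dots,z_n)=\sum_{\sigma\in S_n}\epsilon(\sigma)z_{\sigma(1)}\cdots z_{\sigma(n)}$. A permutation $\sigma$ of $\{1,\dots,\widehat{i},\dots,n+1\}$ is written as an arrangement $\sigma(1),\sigma(2),\dots,\sigma(n)$ of these $n$ numbers, and $\epsilon(\sigma)$ is its sign relative to the increasing arrangement; "$1$ and $2$ do not appear consecutively" means they are not adjacent, in either order, in this arrangement. $F\langle X\rangle$ is the free unital associative algebra, with basis the words $X^*$. Degree-lexicographical order: $u<v$ iff $\deg u<\deg v$, or $\deg u=\deg v$ and at the first position where they differ $u$ has $x_i$ and $v$ has $x_j$ with $i<j$. $\mathrm{LM}(f)$ is the largest word occurring with nonzero coefficient in $f\ne0$. A word $u$ is a factor of $v$ if $v=w_1uw_2$ for some words $w_1,w_2$. A subset $G$ of a two-sided ideal $I$ is a Gröbner basis of $I$ if for every nonzero $f\in I$ there is $g\in G$ such that $\mathrm{LM}(g)$ is a factor of $\mathrm{LM}(f)$. *)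

theory Defs
  imports
    Complex_Main
    "HOL-Library.Poly_Mapping"
    "HOL-Library.List_Lenlexorder"
    "HOL-Library.Sublist"
    "HOL-Combinatorics.Permutations"
    "HOL-Algebra.Ideal"
begin

section \<open>$n$-Lie algebras\<close>

text \<open>The bracket takes its arguments as a list; only lists of length \<open>n\<close> matter.
  Alternating means vanishing on repeated arguments (the right notion in every characteristic).\<close>

locale n_lie_algebra = vector_space scale
  for scale :: "'a::field \<Rightarrow> 'v::ab_group_add \<Rightarrow> 'v" +
  fixes n :: nat and bracket :: "'v list \<Rightarrow> 'v"
  assumes bracket_add: "\<lbrakk>length zs = n; i < n\<rbrakk> \<Longrightarrow>
      bracket (zs[i := u + v]) = bracket (zs[i := u]) + bracket (zs[i := v])"
    and bracket_scale: "\<lbrakk>length zs = n; i < n\<rbrakk> \<Longrightarrow>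
      bracket (zs[i := scale c u]) = scale c (bracket (zs[i := u]))"
    and bracket_alternating: "\<lbrakk>length zs = n; \<not> distinct zs\<rbrakk> \<Longrightarrow> bracket zs = 0"
    and filippov_identity: "\<lbrakk>length zs = n; length ws = n - 1\<rbrakk> \<Longrightarrow>
      bracket (bracket zs # ws) = (\<Sum>i<n. bracket (zs[i := bracket (zs ! i # ws)]))"

text \<open>The increasing list $1,\dots,\widehat{i},\dots,n+1$.\<close>

definition omit :: "nat \<Rightarrow> nat \<Rightarrow> nat list" where
  "omit n i = filter (\<lambda>j. j \<noteq> i) [1..<n + 2]"

text \<open>A bracket of basis elements not listed below has a repeated entry, or is a
  rearrangement of a listed one, so it is determined by the alternating property.\<close>

locale n_lie_algebra_L = n_lie_algebra scale n bracket
  for scale :: "'a::field \<Rightarrow> 'v::ab_group_add \<Rightarrow> 'v" and n bracket +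
  fixes \<beta> :: 'a and e :: "nat \<Rightarrow> 'v"
  assumes basis_inj: "inj_on e {1..n + 1}"
    and basis_independent: "independent (e ` {1..n + 1})"
    and basis_span: "span (e ` {1..n + 1}) = UNIV"
    and bracket_omit_1: "bracket (map e (omit n 1)) = e 1 + scale \<beta> (e 2)"
    and bracket_omit_2: "bracket (map e (omit n 2)) = e 2"
    and bracket_omit_ge_3: "i \<in> {3..n + 1} \<Longrightarrow> bracket (map e (omit n i)) = 0"


section \<open>The free unital associative algebra\<close>

text \<open>Lists form the free monoid, so \<open>'x list \<Rightarrow>\<^sub>0 'a\<close> with its convolution product
  is the monoid algebra of words, with \<open>Poly_Mapping.single w c\<close> the term \<open>c w\<close>.\<close>

instantiation list :: (type) monoid_add
begin
definition zero_list_def: "0 = []"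
definition plus_list_def: "u + v = u @ v"
instance by standard (simp_all add: zero_list_def plus_list_def)
end

definition free_algebra :: "'x set \<Rightarrow> ('x list \<Rightarrow>\<^sub>0 'a::field) ring" where
  "free_algebra X = \<lparr>carrier = {p. Poly_Mapping.keys p \<subseteq> lists X}, mult = (*), one = 1, zero = 0, add = (+)\<rparr>"

definition const :: "'a::field \<Rightarrow> 'x list \<Rightarrow>\<^sub>0 'a" where
  "const c = Poly_Mapping.single [] c"

definition var :: "'x \<Rightarrow> 'x list \<Rightarrow>\<^sub>0 'a::field" where
  "var i = Poly_Mapping.single [i] 1"

text \<open>If \<open>free_algebra X\<close> were not a ring, \<open>genideal\<close> could be an intersection over no ideals.\<close>

lemma ring_free_algebra: "ring (free_algebra X :: ('x list \<Rightarrow>\<^sub>0 'a::field) ring)"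
proof -
  have mult: "Poly_Mapping.keys (p * q) \<subseteq> lists X"
    if "Poly_Mapping.keys p \<subseteq> lists X" "Poly_Mapping.keys q \<subseteq> lists X" for p q :: "'x list \<Rightarrow>\<^sub>0 'a"
    using that keys_mult[of p q] by (fastforce simp: plus_list_def)
  have plus: "Poly_Mapping.keys (p + q) \<subseteq> lists X"
    if "Poly_Mapping.keys p \<subseteq> lists X" "Poly_Mapping.keys q \<subseteq> lists X" for p q :: "'x list \<Rightarrow>\<^sub>0 'a"
    using that keys_add[of p q] by blast
  have one: "Poly_Mapping.keys (1 :: 'x list \<Rightarrow>\<^sub>0 'a) \<subseteq> lists X"
    by (simp add: zero_list_def)
  show ?thesis
  proof (rule ringI)
    show "abelian_group (free_algebra X :: ('x list \<Rightarrow>\<^sub>0 'a) ring)"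
    proof (rule abelian_groupI)
      fix p :: "'x list \<Rightarrow>\<^sub>0 'a" assume "p \<in> carrier (free_algebra X)"
      then have "- p \<in> carrier (free_algebra X)" by (simp add: free_algebra_def)
      then show "\<exists>q\<in>carrier (free_algebra X). q \<oplus>\<^bsub>free_algebra X\<^esub> p = \<zero>\<^bsub>free_algebra X\<^esub>"
        by (intro bexI[of _ "- p"]) (simp_all add: free_algebra_def)
    qed (auto simp: free_algebra_def ac_simps dest: plus[THEN subsetD, rotated 2])
    show "Group.monoid (free_algebra X :: ('x list \<Rightarrow>\<^sub>0 'a) ring)"
      by (rule monoidI) (use mult one in \<open>auto simp: free_algebra_def mult.assoc\<close>)
  qed (simp_all add: free_algebra_def algebra_simps)
qed


section \<open>Groebner bases\<close>

text \<open>The order on words is the one of \<^theory>\<open>HOL-Library.List_Lenlexorder\<close>: shorter words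
  first, words of equal length compared at the first position where they differ.\<close>

definition LM :: "('x::linorder list \<Rightarrow>\<^sub>0 'a::field) \<Rightarrow> 'x list" where
  "LM f = Max (Poly_Mapping.keys f)"

text \<open>\<open>sublist u v\<close> says that \<open>u\<close> is a contiguous factor of \<open>v\<close>. The zero polynomial has no
  leading monomial, hence \<open>g \<noteq> 0\<close>.\<close>

definition groebner_basis ::
  "'x::linorder set \<Rightarrow> ('x list \<Rightarrow>\<^sub>0 'a::field) set \<Rightarrow> ('x list \<Rightarrow>\<^sub>0 'a) set \<Rightarrow> bool" where
  "groebner_basis X G I \<longleftrightarrow> ideal I (free_algebra X) \<and> G \<subseteq> I \<and>
     (\<forall>f\<in>I. f \<noteq> 0 \<longrightarrow> (\<exists>g\<in>G. g \<noteq> 0 \<and> sublist (LM g) (LM f)))"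


section \<open>The elements $G_i$, $K_i$ and $N$\<close>

text \<open>Permutations act on positions \<open>0, \<dots>, length zs - 1\<close>: \<open>permute_list \<sigma> zs\<close> is the
  arrangement \<open>zs ! \<sigma> 0, zs ! \<sigma> 1, \<dots>\<close>. If \<open>zs\<close> is increasing, \<open>sign \<sigma>\<close> is the sign of this
  arrangement relative to the increasing one.\<close>

definition alt :: "'b::ring_1 list \<Rightarrow> 'b" where
  "alt zs = (\<Sum>\<sigma> | \<sigma> permutes {..<length zs}. of_int (sign \<sigma>) * prod_list (permute_list \<sigma> zs))"

definition G_elt :: "nat \<Rightarrow> 'a::field \<Rightarrow> nat \<Rightarrow> nat list \<Rightarrow>\<^sub>0 'a" where
  "G_elt n \<beta> i = (-1) ^ (n div 2) * (alt (map var (omit n i)) -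
     (if i = 1 then var 1 + const \<beta> * var 2 else if i = 2 then var 2 else 0))"

definition adjacent :: "'x \<Rightarrow> 'x \<Rightarrow> 'x list \<Rightarrow> bool" where
  "adjacent a b w \<longleftrightarrow> sublist [a, b] w \<or> sublist [b, a] w"

definition V_perms :: "nat \<Rightarrow> nat \<Rightarrow> (nat \<Rightarrow> nat) set" where
  "V_perms n i = {\<sigma>. \<sigma> permutes {..<n} \<and> \<not> adjacent 1 2 (permute_list \<sigma> (omit n i))}"

definition K_elt :: "nat \<Rightarrow> nat \<Rightarrow> nat list \<Rightarrow>\<^sub>0 'a::field" where
  "K_elt n i = - ((-1) ^ (n div 2)) *
     (\<Sum>\<sigma>\<in>V_perms n i. of_int (sign \<sigma>) * prod_list (map var (permute_list \<sigma> (omit n i))))"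

definition N_elt :: "nat list \<Rightarrow>\<^sub>0 'a::field" where
  "N_elt = var 2 * var 1 - var 1 * var 2"

end

theory Submission
  imports Defs "Jordan_Normal_Form.Determinant"
begin

text \<open>The two families of generators are linked by one identity. Let $A_i$ be the alternating sum
  of all letters but $x_i$. Expanding the alternating sum of all $n+1$ letters along its first
  and along its last factor gives the same polynomial twice; for even $n$ the signs in both
  expansions agree, so $\sum_i (-1)^{i-1} (x_i A_i - A_i x_i) = 0$. As $A_i$ is, up to sign,
  $G_i$ plus a tail of degree at most one, and the tails contribute only $\beta(x_1x_2 - x_2x_1)$,
  the commutators of the $x_i$ with the $G_i$ add up to a multiple of $\beta N$
  (\<open>commutator_identity\<close>). Since $\beta \neq 0$, $N$ lies in the ideal. Modulo $N$ the words of
  $G_i$, $i \geq 3$, in which 1 and 2 are adjacent cancel in pairs, and what is left is $-K_i$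
  (\<open>G_plus_K\<close>). Hence both sets generate the same ideal.

  That the new generators form a Groebner basis is an application of Buchberger's criterion for
  free algebras (\<open>LM_combs_divisible\<close>, \<open>resolvable_if_overlaps\<close>): it is enough to resolve the
  overlaps of leading words. The leading words are $x_{n+1}\cdots x_3x_2$ for $G_1$,
  $x_{n+1}\cdots x_3x_1$ for $G_2$, $x_2x_1$ for $N$, and for $K_i$ the descending word in the
  letters other than $x_1,x_2,x_m,x_i$ followed by $x_2x_mx_1$, where $m$ is the least index at
  least 3 different from $i$. For $n \geq 4$ the only overlap is $x_{n+1}\cdots x_3x_2x_1$, made by
  $G_1$ and $N$ (\<open>G_basis_overlap\<close>). It is resolved by the same commutator identity, read as an
  expression for $G_1x_1$: every other term in it is a multiple of a basis element with a smaller
  leading word, except for multiples of $x_{n+1}\cdots x_3 N$ (\<open>overlap_resolvable\<close>).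

  The criterion is stated with a free scalar, so leading coefficients only have to be nonzero and
  the signs of the leading words never have to be computed.\<close>

section \<open>Two-sided multiples of noncommutative polynomials\<close>

text \<open>Multiples by words are kept separate from products of polynomials because they act
  injectively on words, so that their coefficients and leading words can be read off.\<close>

definition framed :: "'a::field \<Rightarrow> 'x list \<Rightarrow> ('x list \<Rightarrow>\<^sub>0 'a) \<Rightarrow> 'x list \<Rightarrow> 'x list \<Rightarrow>\<^sub>0 'a" where
  "framed c u p v = Poly_Mapping.single u c * p * Poly_Mapping.single v 1"

lemma framed_add: "framed c u (p + q) v = framed c u p v + framed c u q v"
  by (simp add: framed_def algebra_simps)

lemma framed_diff: "framed c u (p - q) v = framed c u p v - framed c u q v"
  by (simp add: framed_def algebra_simps)

lemma framed_zero [simp]: "framed c u 0 v = 0" "framed 0 u p v = 0"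
  by (simp_all add: framed_def)

lemma framed_sum: "framed c u (sum f A) v = (\<Sum>i\<in>A. framed c u (f i) v)"
  by (simp add: framed_def sum_distrib_left sum_distrib_right)

lemma framed_coeff_add: "framed (c + d) u p v = framed c u p v + framed d u p v"
  by (simp add: framed_def single_add algebra_simps)

lemma framed_minus_coeff: "framed (- c) u p v = - framed c u p v"
  by (simp add: framed_def single_uminus)

lemma framed_framed [simp]:
  "framed c u (framed d u' p v') v = framed (c * d) (u @ u') p (v' @ v)"
proof -
  have "framed c u (framed d u' p v') v =
      (Poly_Mapping.single u c * Poly_Mapping.single u' d) * p *
      (Poly_Mapping.single v' 1 * Poly_Mapping.single v 1)"
    by (simp add: framed_def mult.assoc)
  then show ?thesis by (simp add: mult_single plus_list_def framed_def)
qed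

lemma framed_single [simp]:
  "framed c u (Poly_Mapping.single k d) v = Poly_Mapping.single (u @ k @ v) (c * d)"
  by (simp add: framed_def mult_single plus_list_def)

lemma framed_1_Nil [simp]: "framed 1 [] p [] = p"
  by (simp add: framed_def flip: zero_list_def)

lemma poly_mapping_as_sum:
  "p = (\<Sum>k\<in>Poly_Mapping.keys p. Poly_Mapping.single k (Poly_Mapping.lookup p k))"
  by (rule poly_mapping_eqI)
    (auto simp: lookup_sum lookup_single when_def in_keys_iff)

text \<open>Scalars are central, so a word on the right may bring its coefficient to the left.\<close>

lemma times_single: "p * Poly_Mapping.single k c = framed c [] p k"
proof -
  have "p * Poly_Mapping.single k c =
      (\<Sum>l\<in>Poly_Mapping.keys p. Poly_Mapping.single (l @ k) (Poly_Mapping.lookup p l * c))"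
    by (subst poly_mapping_as_sum[of p]) (simp add: sum_distrib_right mult_single plus_list_def)
  moreover have "framed c [] p k =
      (\<Sum>l\<in>Poly_Mapping.keys p. Poly_Mapping.single (l @ k) (c * Poly_Mapping.lookup p l))"
    by (subst poly_mapping_as_sum[of p]) (simp add: framed_sum)
  ultimately show ?thesis by (simp add: mult.commute)
qed

lemma lookup_framed:
  "Poly_Mapping.lookup (framed c u p v) (u @ k @ v) = c * Poly_Mapping.lookup p k"
proof -
  have "framed c u p v =
      (\<Sum>k\<in>Poly_Mapping.keys p. Poly_Mapping.single (u @ k @ v) (c * Poly_Mapping.lookup p k))"
    by (subst poly_mapping_as_sum[of p]) (simp add: framed_sum)
  then show ?thesis
    by (auto simp: lookup_sum lookup_single when_def in_keys_iff)
qed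

lemma keys_framed: "Poly_Mapping.keys (framed c u p v) \<subseteq> (\<lambda>k. u @ k @ v) ` Poly_Mapping.keys p"
proof -
  have "framed c u p v =
      (\<Sum>k\<in>Poly_Mapping.keys p. Poly_Mapping.single (u @ k @ v) (c * Poly_Mapping.lookup p k))"
    by (subst poly_mapping_as_sum[of p]) (simp add: framed_sum)
  then show ?thesis
    by (auto simp: in_keys_iff lookup_sum lookup_single when_def split: if_splits
        elim!: sum.not_neutral_contains_not_neutral)
qed

lemma append_left_less_iff [simp]: "u @ k < u @ l \<longleftrightarrow> k < (l :: 'x::linorder list)"
  by (simp add: list_less_def irrefl_def)

lemma append_right_less: "k < l \<Longrightarrow> k @ v < l @ (v :: 'x::linorder list)"
  unfolding list_less_def by (rule lenlex_append1) simp_all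

lemma append_right_less_iff [simp]: "k @ v < l @ v \<longleftrightarrow> k < (l :: 'x::linorder list)"
  by (metis append_right_less less_asym linorder_neqE)

lemma LM_in_keys: "f \<noteq> 0 \<Longrightarrow> LM f \<in> Poly_Mapping.keys f"
  unfolding LM_def by (rule Max_in) simp_all

lemma lookup_LM: "f \<noteq> 0 \<Longrightarrow> Poly_Mapping.lookup f (LM f) \<noteq> 0"
  using LM_in_keys[of f] by (simp add: in_keys_iff)

lemma keys_le_LM: "k \<in> Poly_Mapping.keys f \<Longrightarrow> k \<le> LM f"
  unfolding LM_def by (rule Max_ge) simp_all

lemma LM_eqI:
  assumes "w \<in> Poly_Mapping.keys f" "Poly_Mapping.keys f \<subseteq> {..w}"
  shows "LM f = w"
  unfolding LM_def using assms by (intro Max_eqI) auto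

text \<open>The set \<open>W\<close> restricts the leading words of the summands, not that of the sum: membership
  in \<open>combs G {..<w}\<close> says that a polynomial has a representation by multiples of \<open>G\<close> whose
  leading words, before any cancellation, are below \<open>w\<close>. With \<open>W = UNIV\<close> it is the two-sided
  ideal generated by \<open>G\<close> in the algebra on all letters of the type.\<close>

inductive_set combs :: "('x::linorder list \<Rightarrow>\<^sub>0 'a::field) set \<Rightarrow> 'x list set \<Rightarrow> ('x list \<Rightarrow>\<^sub>0 'a) set"
  for G W where
  combs_0: "0 \<in> combs G W"
| combs_step: "\<lbrakk>p \<in> combs G W; g \<in> G; u @ LM g @ v \<in> W\<rbrakk> \<Longrightarrow> framed c u g v + p \<in> combs G W"

lemma combs_framed: "\<lbrakk>g \<in> G; u @ LM g @ v \<in> W\<rbrakk> \<Longrightarrow> framed c u g v \<in> combs G W"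
  using combs_step[OF combs_0] by fastforce

lemma combs_mono:
  assumes "p \<in> combs G W" "G \<subseteq> G'" "W \<subseteq> W'"
  shows "p \<in> combs G' W'"
  using assms by (induction rule: combs.induct) (auto intro: combs.intros)

lemma combs_add:
  assumes "p \<in> combs G W" "q \<in> combs G W"
  shows "p + q \<in> combs G W"
  using assms by (induction rule: combs.induct) (auto intro: combs.intros simp: add.assoc)

lemma combs_sum: "(\<And>i. i \<in> A \<Longrightarrow> f i \<in> combs G W) \<Longrightarrow> sum f A \<in> combs G W"
  by (induction A rule: infinite_finite_induct) (auto intro: combs_0 combs_add)

lemma framed_in_combs:
  assumes "p \<in> combs G W" "\<And>w. w \<in> W \<Longrightarrow> a @ w @ b \<in> W'"
  shows "framed c a p b \<in> combs G W'"
  using assms(1)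
proof (induction rule: combs.induct)
  case (combs_step p g u v d)
  then show ?case
    using assms(2)[of "u @ LM g @ v"] by (auto simp: framed_add intro: combs.combs_step)
qed (simp add: combs_0)

lemma combs_scale: "p \<in> combs G W \<Longrightarrow> framed c [] p [] \<in> combs G W"
  by (rule framed_in_combs) simp_all

lemma combs_uminus: "p \<in> combs G W \<Longrightarrow> - p \<in> combs G W"
  using combs_scale[of p G W "-1"] by (simp add: framed_def single_uminus flip: zero_list_def)

lemma combs_diff: "\<lbrakk>p \<in> combs G W; q \<in> combs G W\<rbrakk> \<Longrightarrow> p - q \<in> combs G W"
  using combs_add[of p G W "- q"] combs_uminus[of q G W] by simp

lemma combs_mult_poly:
  assumes "g \<in> G" "\<And>k. k \<in> Poly_Mapping.keys p \<Longrightarrow> k @ LM g @ v \<in> W"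
  shows "p * g * Poly_Mapping.single v 1 \<in> combs G W"
proof -
  have "p * g * Poly_Mapping.single v 1 =
      (\<Sum>k\<in>Poly_Mapping.keys p. framed (Poly_Mapping.lookup p k) k g v)"
    by (subst poly_mapping_as_sum[of p]) (simp add: sum_distrib_right framed_def)
  then show ?thesis using assms by (auto intro!: combs_sum combs_framed)
qed

lemma combs_poly_mult:
  assumes "g \<in> G" "\<And>k. k \<in> Poly_Mapping.keys p \<Longrightarrow> u @ LM g @ k \<in> W"
  shows "Poly_Mapping.single u 1 * g * p \<in> combs G W"
proof -
  have "Poly_Mapping.single u 1 * g * Poly_Mapping.single k c = framed c u g k" for k c
  proof -
    have "Poly_Mapping.single u 1 * g * Poly_Mapping.single k c =
        framed c [] (framed 1 u g []) k"
      unfolding times_single by (simp add: framed_def flip: zero_list_def)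
    then show ?thesis by simp
  qed
  then have "Poly_Mapping.single u 1 * g * p =
      (\<Sum>k\<in>Poly_Mapping.keys p. framed (Poly_Mapping.lookup p k) u g k)"
    by (subst poly_mapping_as_sum[of p]) (simp add: sum_distrib_left)
  then show ?thesis using assms by (auto intro!: combs_sum combs_framed)
qed

lemma combs_left_ideal: "p \<in> combs G UNIV \<Longrightarrow> q * p \<in> combs G UNIV"
proof -
  assume p: "p \<in> combs G UNIV"
  have "q * p = (\<Sum>k\<in>Poly_Mapping.keys q. framed (Poly_Mapping.lookup q k) k p [])"
    by (subst poly_mapping_as_sum[of q])
      (simp add: sum_distrib_right framed_def flip: zero_list_def)
  then show ?thesis using p by (auto intro!: combs_sum framed_in_combs)
qed

lemma combs_right_ideal: "p \<in> combs G UNIV \<Longrightarrow> p * q \<in> combs G UNIV"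
proof (induction rule: combs.induct)
  case (combs_step p g u v c)
  have "Poly_Mapping.single u 1 * g * (Poly_Mapping.single v 1 * q) \<in> combs G UNIV"
    using combs_step by (intro combs_poly_mult) auto
  then have "framed c [] (Poly_Mapping.single u 1 * g * (Poly_Mapping.single v 1 * q)) [] \<in> combs G UNIV"
    by (rule combs_scale)
  moreover have "framed c [] (Poly_Mapping.single u 1 * g * (Poly_Mapping.single v 1 * q)) [] = framed c u g v * q"
  proof -
    have 1: "Poly_Mapping.single u c = Poly_Mapping.single [] c * Poly_Mapping.single u 1"
      by (simp add: mult_single plus_list_def)
    have 2: "Poly_Mapping.single [] 1 = (1 :: 'a list \<Rightarrow>\<^sub>0 'b)"
      by (simp flip: zero_list_def)
    show ?thesis unfolding framed_def 1 2 by (simp only: mult.assoc mult_1_right)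
  qed
  ultimately have "framed c u g v * q \<in> combs G UNIV" by (simp only:)
  then show ?case unfolding distrib_right by (rule combs_add) (rule combs_step.IH)
qed (simp add: combs_0)

lemma keys_combs:
  assumes "p \<in> combs G W" "k \<in> Poly_Mapping.keys p"
  shows "\<exists>w\<in>W. k \<le> w"
  using assms
proof (induction arbitrary: k rule: combs.induct)
  case (combs_step p g u v c)
  consider "k \<in> Poly_Mapping.keys p" | l where "l \<in> Poly_Mapping.keys g" "k = u @ l @ v"
    using combs_step.prems keys_add[of "framed c u g v" p] keys_framed[of c u g v] by blast
  then show ?case
  proof cases
    case 2
    then have "k \<le> u @ LM g @ v"
      using keys_le_LM[of l g] by (auto simp: le_less)
    then show ?thesis using combs_step by blast
  qed (use combs_step in blast)
qed simp

lemma lookup_combs_lessThan: "p \<in> combs G {..<w} \<Longrightarrow> Poly_Mapping.lookup p w = 0"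
  using keys_combs[of p G "{..<w}" w] by (force simp: in_keys_iff)

lemma combs_bounded:
  assumes "p \<in> combs G W" "p \<noteq> 0"
  shows "\<exists>w\<in>W. p \<in> combs G {..w}"
  using assms
proof (induction rule: combs.induct)
  case (combs_step p g u v c)
  let ?w = "u @ LM g @ v"
  have t: "framed c u g v \<in> combs G {..?w}" using combs_step by (intro combs_framed) auto
  show ?case
  proof (cases "p = 0")
    case True
    then show ?thesis using t combs_step by (metis add_0_right)
  next
    case False
    then obtain w where w: "w \<in> W" "p \<in> combs G {..w}" using combs_step by blast
    have "framed c u g v + p \<in> combs G {..max ?w w}"
      by (intro combs_add combs_mono[OF t] combs_mono[OF w(2)]) auto
    moreover have "max ?w w \<in> W" using w combs_step by (simp add: max_def)
    ultimately show ?thesis by blast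
  qed
qed simp

section \<open>Buchberger's criterion in a free algebra\<close>

text \<open>Meant for two multiples with the same leading word. The scalar replaces the usual
  assumption that the elements of \<open>G\<close> are monic.\<close>

definition resolvable where
  "resolvable G u g v u' g' v' \<longleftrightarrow>
     (\<exists>c. framed 1 u g v - framed c u' g' v' \<in> combs G {..<u @ LM g @ v})"

text \<open>Comparing coefficients at the common leading word shows that the scalar is nonzero, so
  the relation can be divided by it.\<close>

lemma resolvable_sym:
  assumes "resolvable G u g v u' g' v'" "u @ LM g @ v = u' @ LM g' @ v'" "g \<noteq> 0"
  shows "resolvable G u' g' v' u g v"
proof -
  let ?w = "u @ LM g @ v"
  obtain c where c: "framed 1 u g v - framed c u' g' v' \<in> combs G {..<?w}"
    using assms(1) unfolding resolvable_def by blast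
  have "Poly_Mapping.lookup g (LM g) = c * Poly_Mapping.lookup g' (LM g')"
    using lookup_combs_lessThan[OF c] lookup_framed[of 1 u g v "LM g"]
      lookup_framed[of c u' g' v' "LM g'"] assms(2) by (simp add: lookup_minus)
  then have "c \<noteq> 0" using lookup_LM[OF assms(3)] by auto
  then have "framed 1 u' g' v' - framed (inverse c) u g v =
      framed (- inverse c) [] (framed 1 u g v - framed c u' g' v') []"
    by (simp add: framed_diff framed_minus_coeff)
  then show ?thesis
    using combs_scale[OF c] assms(2) unfolding resolvable_def by metis
qed

text \<open>Resolvability makes all multiples with leading word \<open>w\<close> proportional modulo smaller ones,
  so the top part of a representation collapses to a single term.\<close>

lemma combs_atMost_cases:
  assumes "f \<in> combs G {..w}"
    and res: "\<And>g g' u v u' v'. \<lbrakk>g \<in> G; g' \<in> G; u @ LM g @ v = u' @ LM g' @ v'\<rbrakk> \<Longrightarrow>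
      resolvable G u g v u' g' v'"
  shows "f \<in> combs G {..<w} \<or>
    (\<exists>c u g v. g \<in> G \<and> u @ LM g @ v = w \<and> f - framed c u g v \<in> combs G {..<w})"
  using assms(1)
proof (induction rule: combs.induct)
  case (combs_step p g u v c)
  show ?case
  proof (cases "u @ LM g @ v = w")
    case False
    then have t: "framed c u g v \<in> combs G {..<w}" using combs_step by (intro combs_framed) auto
    from combs_step.IH show ?thesis
    proof (elim disjE exE conjE)
      fix d u' g' v' assume *: "g' \<in> G" "u' @ LM g' @ v' = w" "p - framed d u' g' v' \<in> combs G {..<w}"
      have "framed c u g v + p - framed d u' g' v' \<in> combs G {..<w}"
        using combs_add[OF t *(3)] by (simp add: add_diff_eq)
      then show ?thesis using * by blast
    qed (use t combs_add in blast)
  next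
    case True
    from combs_step.IH show ?thesis
    proof (elim disjE exE conjE)
      assume "p \<in> combs G {..<w}"
      then have "framed c u g v + p - framed c u g v \<in> combs G {..<w}" by simp
      then show ?thesis using True combs_step by blast
    next
      fix d u' g' v' assume *: "g' \<in> G" "u' @ LM g' @ v' = w" "p - framed d u' g' v' \<in> combs G {..<w}"
      obtain b where b: "framed 1 u g v - framed b u' g' v' \<in> combs G {..<w}"
        using res[of g g' u v u' v'] True * combs_step unfolding resolvable_def by auto
      have "framed c [] (framed 1 u g v - framed b u' g' v') [] + (p - framed d u' g' v')
          \<in> combs G {..<w}"
        using combs_add[OF combs_scale[OF b] *(3)] .
      then have "framed c u g v + p - framed (c * b + d) u' g' v' \<in> combs G {..<w}"
        by (simp add: framed_diff framed_coeff_add algebra_simps)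
      then show ?thesis using * by blast
    qed
  qed
qed (simp add: combs_0)

text \<open>Among all representations of \<open>f\<close> take one whose bound \<open>w\<close> is least. Its top part is one
  term; by minimality that term does not vanish, so nothing cancels at \<open>w\<close> and \<open>w\<close> is the
  leading word of \<open>f\<close>.\<close>

lemma LM_combs_divisible:
  fixes G :: "('x::wellorder list \<Rightarrow>\<^sub>0 'a::field) set"
  assumes res: "\<And>g g' u v u' v'. \<lbrakk>g \<in> G; g' \<in> G; u @ LM g @ v = u' @ LM g' @ v'\<rbrakk> \<Longrightarrow>
      resolvable G u g v u' g' v'"
    and nz: "0 \<notin> G"
    and f: "f \<in> combs G UNIV" "f \<noteq> 0"
  shows "\<exists>g\<in>G. g \<noteq> 0 \<and> sublist (LM g) (LM f)"
proof -
  define w where "w = (LEAST w. f \<in> combs G {..w})"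
  have "\<exists>w. f \<in> combs G {..w}" using combs_bounded[OF f] by blast
  then have w: "f \<in> combs G {..w}" unfolding w_def by (rule LeastI_ex)
  have not_below: "f \<notin> combs G {..<w}"
  proof
    assume "f \<in> combs G {..<w}"
    then obtain w' where "w' < w" "f \<in> combs G {..w'}" using combs_bounded f by blast
    then show False unfolding w_def by (metis not_less_Least)
  qed
  then obtain c u g v where *: "g \<in> G" "u @ LM g @ v = w" "f - framed c u g v \<in> combs G {..<w}"
    using combs_atMost_cases[OF w res] by blast
  then have "c \<noteq> 0" using not_below by auto
  have "g \<noteq> 0" using nz * by auto
  have "Poly_Mapping.lookup f w = c * Poly_Mapping.lookup g (LM g)"
    using lookup_combs_lessThan[OF *(3)] lookup_framed[of c u g v "LM g"] *(2)
    by (simp add: lookup_minus)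
  also have "\<dots> \<noteq> 0" using \<open>c \<noteq> 0\<close> lookup_LM[OF \<open>g \<noteq> 0\<close>] by simp
  finally have "w \<in> Poly_Mapping.keys f" by (simp add: in_keys_iff)
  moreover have "Poly_Mapping.keys f \<subseteq> {..w}" using keys_combs[OF w] by force
  ultimately have "LM f = w" by (rule LM_eqI)
  then show ?thesis using * \<open>g \<noteq> 0\<close> by (metis sublist_appendI)
qed

lemma keys_diff_leading:
  fixes g :: "'x::linorder list \<Rightarrow>\<^sub>0 'a::field"
  assumes "k \<in> Poly_Mapping.keys (g - Poly_Mapping.single (LM g) (Poly_Mapping.lookup g (LM g)))"
  shows "k < LM g"
proof -
  have "k \<noteq> LM g" using assms by (auto simp: in_keys_iff lookup_minus)
  moreover have "k \<in> Poly_Mapping.keys g"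
    using assms \<open>k \<noteq> LM g\<close> by (auto simp: in_keys_iff lookup_minus lookup_single when_def)
  ultimately show ?thesis using keys_le_LM[of k g] by simp
qed

text \<open>If the two leading words do not meet inside the common word, write $g = a\,l + r$ and
  $g' = a'l' + r'$ with leading words $l, l'$. Then $u\,g\,b\,g'v$ can be expanded on either side:
  it is $a'\,u\,g\,b\,l'v$ up to $u\,g\,b\,r'v$, and $a\,u\,l\,b\,g'v$ up to $u\,r\,b\,g'v$, and both errors have
  smaller leading words.\<close>

lemma resolvable_disjoint:
  fixes G :: "('x::linorder list \<Rightarrow>\<^sub>0 'a::field) set"
  assumes "g \<in> G" "g' \<in> G" "g' \<noteq> 0"
  shows "resolvable G u g (b @ LM g' @ v) (u @ LM g @ b) g' v"
proof -
  let ?a = "Poly_Mapping.lookup g (LM g)" and ?a' = "Poly_Mapping.lookup g' (LM g')"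
  let ?s = "\<lambda>w. Poly_Mapping.single w (1::'a)"
  define r where "r = g - Poly_Mapping.single (LM g) ?a"
  define r' where "r' = g' - Poly_Mapping.single (LM g') ?a'"
  let ?W = "{..<u @ LM g @ b @ LM g' @ v}"
  have [simp]: "?s u * ?s v = ?s (u @ v)" for u v by (simp add: mult_single plus_list_def)
  have key: "framed a u r w = framed 1 [] (Poly_Mapping.single u a * r) w" for a u r and w :: "'x list"
    by (simp add: framed_def flip: zero_list_def)
  have 1: "(?s u * r * ?s b) * g' * ?s v \<in> combs G ?W"
  proof (rule combs_mult_poly)
    fix k assume "k \<in> Poly_Mapping.keys (?s u * r * ?s b)"
    then obtain l where "l \<in> Poly_Mapping.keys r" "k = u @ l @ b"
      using keys_framed[of 1 u r b] by (auto simp: framed_def)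
    then show "k @ LM g' @ v \<in> ?W"
      using keys_diff_leading[of l g] by (simp add: r_def)
  qed fact
  have 2: "?s u * g * (?s b * r' * ?s v) \<in> combs G ?W"
  proof (rule combs_poly_mult)
    fix k assume "k \<in> Poly_Mapping.keys (?s b * r' * ?s v)"
    then obtain l where "l \<in> Poly_Mapping.keys r'" "k = b @ l @ v"
      using keys_framed[of 1 b r' v] by (auto simp: framed_def)
    then show "u @ LM g @ k \<in> ?W"
      using keys_diff_leading[of l g'] by (simp add: r'_def)
  qed fact
  have 3: "framed 1 u g (b @ LM g' @ v) =
    framed (inverse ?a') [] (?s u * g * ?s b * g' * ?s v - ?s u * g * (?s b * r' * ?s v)) []"
  proof -
    have "?s u * g * ?s b * g' * ?s v - ?s u * g * (?s b * r' * ?s v) =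
      ?s u * g * (framed 1 b (g' - r') v)"
      by (simp add: framed_diff framed_def algebra_simps)
    also have "\<dots> = ?s u * g * Poly_Mapping.single (b @ LM g' @ v) ?a'"
      by (simp add: r'_def)
    finally have *: "?s u * g * ?s b * g' * ?s v - ?s u * g * (?s b * r' * ?s v) = \<dots>" .
    show ?thesis unfolding * unfolding times_single[of "?s u * g"] using lookup_LM[OF assms(3)]
      by simp (simp add: framed_def mult.assoc flip: zero_list_def)
  qed
  have 4: "framed ?a (u @ LM g @ b) g' v =
    ?s u * g * ?s b * g' * ?s v - (?s u * r * ?s b) * g' * ?s v"
  proof -
    have "?s u * g * ?s b * g' * ?s v - (?s u * r * ?s b) * g' * ?s v =
      framed 1 u (g - r) b * g' * ?s v"
      by (simp add: framed_diff framed_def algebra_simps)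
    also have "\<dots> = framed ?a (u @ LM g @ b) g' v"
      by (simp add: r_def) (simp add: framed_def)
    finally show ?thesis by simp
  qed
  have "framed 1 u g (b @ LM g' @ v) - framed (inverse ?a' * ?a) (u @ LM g @ b) g' v =
    framed (inverse ?a') [] ((?s u * r * ?s b) * g' * ?s v - ?s u * g * (?s b * r' * ?s v)) []"
  proof -
    have 5: "framed (inverse ?a' * ?a) (u @ LM g @ b) g' v =
      framed (inverse ?a') [] (?s u * g * ?s b * g' * ?s v - (?s u * r * ?s b) * g' * ?s v) []"
      by (simp flip: 4)
    have swap: "x - y - (x - z) = z - y" for x y z :: "'x list \<Rightarrow>\<^sub>0 'a"
      by simp
    show ?thesis unfolding 3 5 framed_diff by (rule swap)
  qed
  also have "\<dots> \<in> combs G ?W" using 1 2 by (intro combs_scale combs_diff)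
  finally show ?thesis unfolding resolvable_def by auto
qed

lemma append_eq_append_le:
  "\<lbrakk>xs @ ys = zs @ ts; length xs \<le> length zs\<rbrakk> \<Longrightarrow> \<exists>us. zs = xs @ us \<and> ys = us @ ts"
  by (auto simp: append_eq_append_conv2)

text \<open>Two occurrences of leading words in a common word are disjoint, nested, or properly
  overlapping. Nested ones are excluded unless they coincide, and for overlapping ones the
  assumption is transported by multiplying with the remaining outer words.\<close>

lemma resolvable_if_overlaps:
  fixes G :: "('x::linorder list \<Rightarrow>\<^sub>0 'a::field) set"
  assumes nz: "0 \<notin> G"
    and incl: "\<And>g g'. \<lbrakk>g \<in> G; g' \<in> G; sublist (LM g') (LM g)\<rbrakk> \<Longrightarrow> g = g'"
    and over: "\<And>g g' a b d. \<lbrakk>g \<in> G; g' \<in> G; LM g = a @ b; LM g' = b @ d; a \<noteq> []; b \<noteq> []; d \<noteq> []\<rbrakk>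
      \<Longrightarrow> resolvable G [] g d a g' []"
    and g: "g \<in> G" "g' \<in> G" and eq: "u @ LM g @ v = u' @ LM g' @ v'"
  shows "resolvable G u g v u' g' v'"
proof -
  have main: "resolvable G u g v u' g' v'"
    if g: "g \<in> G" "g' \<in> G" and eq: "u @ LM g @ v = u' @ LM g' @ v'" and le: "length u \<le> length u'"
    for g g' u v u' v'
  proof -
    obtain a where a: "u' = u @ a" "LM g @ v = a @ LM g' @ v'"
      using append_eq_append_le[OF eq le] by blast
    consider (disj) b where "a = LM g @ b" "v = b @ LM g' @ v'"
      | (over) b where "LM g = a @ b" "b @ v = LM g' @ v'" "b \<noteq> []"
    proof (cases "length (LM g) \<le> length a")
      case True
      then have "\<exists>b. a = LM g @ b \<and> v = b @ LM g' @ v'"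
        by (rule append_eq_append_le[OF a(2)])
      then show ?thesis using disj by blast
    next
      case False
      then have "\<exists>b. LM g = a @ b \<and> b @ v = LM g' @ v' \<and> b \<noteq> []"
        using append_eq_append_le[OF a(2)[symmetric]] by force
      then show ?thesis using over by blast
    qed
    then show ?thesis
    proof cases
      case disj
      then show ?thesis using resolvable_disjoint[of g G g' u b v'] g nz a by auto
    next
      case over': over
      have same: ?thesis if "g = g'" "a = []"
        using that a(1,2) combs_0 unfolding resolvable_def by (intro exI[of _ 1]) simp
      consider (incl) d where "b = LM g' @ d" | (ov) d where "LM g' = b @ d" "v = d @ v'" "d \<noteq> []"
        using append_eq_append_le[OF over'(2)] append_eq_append_le[OF over'(2)[symmetric]]
        by (metis append_Nil2 nle_le)
      then show ?thesis
      proof cases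
        case incl': incl
        then have "sublist (LM g') (LM g)" using over'(1) by (simp add: sublist_def) blast
        then have "g = g'" using incl g by blast
        then have "length (LM g) = length a + length (LM g) + length d"
          using incl' over'(1) by (metis append_assoc length_append)
        then have "a = []" by simp
        with \<open>g = g'\<close> show ?thesis by (rule same)
      next
        case ov
        show ?thesis
        proof (cases "a = []")
          case True
          then have "sublist (LM g) (LM g')" using over'(1) ov by auto
          then show ?thesis using same True incl g by blast
        next
          case False
          then have "resolvable G [] g d a g' []" using over[OF g over'(1) ov(1)] over'(3) ov(3) by blast
          then obtain c where "framed 1 [] g d - framed c a g' [] \<in> combs G {..<LM g @ d}"
            unfolding resolvable_def by auto
          then have "framed 1 u (framed 1 [] g d - framed c a g' []) v' \<in> combs G {..<u @ LM g @ v}"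
            by (rule framed_in_combs) (use append_right_less[of _ "LM g @ d" v'] in \<open>simp add: ov(2)\<close>)
          then show ?thesis
            unfolding resolvable_def using a(1) ov(2) by (auto simp: framed_diff)
        qed
      qed
    qed
  qed
  show ?thesis
  proof (cases "length u \<le> length u'")
    case True
    then show ?thesis using main[OF g eq] by blast
  next
    case False
    then have "resolvable G u' g' v' u g v" using main[OF g(2) g(1) eq[symmetric]] by simp
    then show ?thesis using resolvable_sym[OF _ eq[symmetric]] nz g by metis
  qed
qed

section \<open>Expanding alternating sums along a factor\<close>

definition drop_nth :: "nat \<Rightarrow> 'b list \<Rightarrow> 'b list" where
  "drop_nth j zs = take j zs @ drop (Suc j) zs"

lemma length_drop_nth: "j < length zs \<Longrightarrow> length (drop_nth j zs) = length zs - 1"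
  by (simp add: drop_nth_def)

lemma nth_drop_nth:
  assumes "length zs = Suc m" "j < Suc m" "k < m"
  shows "drop_nth j zs ! k = zs ! (if k < j then k else Suc k)"
  using assms by (auto simp: drop_nth_def nth_append)

text \<open>The Laplace expansion behind both expansions below: permutations are grouped by the
  letter \<open>j\<close> at position \<open>i\<close>, and inserting \<open>i \<mapsto> j\<close> into a permutation of the remaining
  positions changes its sign by \<open>(-1) ^ (i + j)\<close>.\<close>

lemma alt_group:
  fixes zs :: "'b::ring_1 list"
  assumes len: "length zs = Suc m" and i: "i < Suc m"
  shows "alt zs = (\<Sum>j<Suc m. \<Sum>q | q permutes {..<m}. (-1) ^ (i + j) *
    (of_int (sign q) * prod_list (permute_list (permutation_insert i j q) zs)))"
proof -
  let ?f = "\<lambda>p. of_int (sign p) * prod_list (permute_list p zs)"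
  have "alt zs = sum ?f {p. p permutes {..<Suc m}}" by (simp add: alt_def len)
  also have "\<dots> = (\<Sum>j<Suc m. sum ?f {p \<in> {p. p permutes {..<Suc m}}. p i = j})"
    using i permutes_in_image[of _ "{..<Suc m}" i]
    by (intro sum.group[symmetric]) (auto simp: finite_permutations)
  also have "\<dots> = (\<Sum>j<Suc m. \<Sum>q | q permutes {..<m}. (-1) ^ (i + j) *
    (of_int (sign q) * prod_list (permute_list (permutation_insert i j q) zs)))"
  proof (rule sum.cong[OF refl])
    fix j assume "j \<in> {..<Suc m}"
    then have j: "j < Suc m" by simp
    have "{p \<in> {p. p permutes {..<Suc m}}. p i = j} = permutation_insert i j ` {q. q permutes {..<m}}"
      using permutation_fix[OF i j] by (simp add: atLeast0LessThan)
    moreover have "inj_on (permutation_insert i j) {q. q permutes {..<m}}"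
      using permutation_insert_inj_on[OF i j] by (simp add: atLeast0LessThan)
    moreover have "of_int (sign (permutation_insert i j q)) = (-1) ^ (i + j) * (of_int (sign q) :: 'b)"
      if "q permutes {..<m}" for q
      using signof_permutation_insert[OF _ i j, of q] that by (simp add: atLeast0LessThan)
    ultimately show "sum ?f {p \<in> {p. p permutes {..<Suc m}}. p i = j} =
      (\<Sum>q | q permutes {..<m}. (-1) ^ (i + j) *
        (of_int (sign q) * prod_list (permute_list (permutation_insert i j q) zs)))"
      by (simp add: sum.reindex mult.assoc)
  qed
  finally show ?thesis .
qed

lemma permute_list_insert_first:
  assumes len: "length zs = Suc m" and j: "j < Suc m" and q: "q permutes {..<m}"
  shows "permute_list (permutation_insert 0 j q) zs = zs ! j # permute_list q (drop_nth j zs)"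
proof -
  have "q k < m" if "k < m" for k using that q by (metis lessThan_iff permutes_in_image)
  then show ?thesis
    unfolding permute_list_def
    using len j by (intro nth_equalityI)
      (auto simp: length_drop_nth nth_drop_nth nth_Cons permutation_insert_expand simp del: upt_Suc split: nat.splits)
qed

lemma permute_list_insert_last:
  assumes len: "length zs = Suc m" and j: "j < Suc m" and q: "q permutes {..<m}"
  shows "permute_list (permutation_insert m j q) zs = permute_list q (drop_nth j zs) @ [zs ! j]"
proof -
  have "q k < m" if "k < m" for k using that q by (metis lessThan_iff permutes_in_image)
  then show ?thesis
    unfolding permute_list_def
    using len j by (intro nth_equalityI)
      (auto simp: length_drop_nth nth_drop_nth nth_append permutation_insert_expand less_Suc_eq simp del: upt_Suc)
qed

lemma alt_expand_first:
  assumes "length zs = Suc m"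
  shows "alt zs = (\<Sum>j<Suc m. (-1) ^ j * (zs ! j * alt (drop_nth j zs)))"
proof -
  have comm: "of_int k * (x * y) = x * (of_int k * y)" for k and x y :: 'a
    by (metis mult.assoc mult_of_int_commute)
  have "(\<Sum>q | q permutes {..<m}. (-1) ^ (0 + j) *
      (of_int (sign q) * prod_list (permute_list (permutation_insert 0 j q) zs))) =
      (-1) ^ j * (zs ! j * alt (drop_nth j zs))" if "j < Suc m" for j
    using that assms
    by (auto simp: alt_def length_drop_nth sum_distrib_left permute_list_insert_first comm intro!: sum.cong)
  then show ?thesis unfolding alt_group[OF assms zero_less_Suc] by (intro sum.cong) auto
qed

lemma alt_expand_last:
  assumes "length zs = Suc m"
  shows "alt zs = (\<Sum>j<Suc m. (-1) ^ (m + j) * (alt (drop_nth j zs) * zs ! j))"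
proof -
  have "(\<Sum>q | q permutes {..<m}. (-1) ^ (m + j) *
      (of_int (sign q) * prod_list (permute_list (permutation_insert m j q) zs))) =
      (-1) ^ (m + j) * (alt (drop_nth j zs) * zs ! j)" if "j < Suc m" for j
    using that assms
    by (auto simp: alt_def length_drop_nth sum_distrib_left sum_distrib_right permute_list_insert_last
        mult.assoc intro!: sum.cong)
  then show ?thesis unfolding alt_group[OF assms lessI] by (intro sum.cong) auto
qed

text \<open>The expansions along the first and the last factor differ in sign by \<open>(-1) ^ m\<close>, so for
  even \<open>m\<close> they can be subtracted term by term.\<close>

lemma alt_commutator_sum:
  assumes "length zs = Suc m" "even m"
  shows "(\<Sum>j<Suc m. (-1) ^ j * (zs ! j * alt (drop_nth j zs) - alt (drop_nth j zs) * zs ! j)) = 0"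
proof -
  have "(-1 :: 'a) ^ (m + j) = (-1) ^ j" for j using assms(2) by (simp add: power_add)
  then show ?thesis
    using alt_expand_first[OF assms(1)] alt_expand_last[OF assms(1)]
    by (simp add: right_diff_distrib sum_subtractf)
qed

lemma omit_as_drop_nth:
  assumes "j < Suc n"
  shows "omit n (Suc j) = drop_nth j [1..<n + 2]"
proof -
  have "[1..<n + 2] = [1..<Suc j] @ [Suc j..<n + 2]"
    using assms upt_add_eq_append[of 1 "Suc j" "n + 1 - j"] by (simp del: upt_Suc)
  also have "[Suc j..<n + 2] = Suc j # [Suc (Suc j)..<n + 2]"
    using assms by (simp add: upt_conv_Cons del: upt_Suc)
  finally have split: "[1..<n + 2] = [1..<Suc j] @ Suc j # [Suc (Suc j)..<n + 2]" .
  have filter: "filter (\<lambda>k. k \<noteq> Suc j) [1..<Suc j] = [1..<Suc j]"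
    "filter (\<lambda>k. k \<noteq> Suc j) [Suc (Suc j)..<n + 2] = [Suc (Suc j)..<n + 2]"
    by (auto intro!: filter_True simp del: upt_Suc)
  show ?thesis unfolding omit_def drop_nth_def split filter_append
    using filter by (simp del: upt_Suc)
qed

lemma drop_nth_map: "drop_nth j (map f zs) = map f (drop_nth j zs)"
  by (simp add: drop_nth_def take_map drop_map)

section \<open>Signed sums of arrangements\<close>

text \<open>Covers at once the full alternating sums in the \<open>G_elt\<close> and the partial ones in the
  \<open>K_elt\<close>.\<close>

definition signed_words :: "(nat \<Rightarrow> nat) set \<Rightarrow> 'x list \<Rightarrow> 'x list \<Rightarrow>\<^sub>0 'a::field" where
  "signed_words S zs = (\<Sum>\<sigma>\<in>S. Poly_Mapping.single (permute_list \<sigma> zs) (of_int (sign \<sigma>)))"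

lemma single_Nil_1: "Poly_Mapping.single [] 1 = (1 :: 'x list \<Rightarrow>\<^sub>0 'a::field)"
  by (simp flip: zero_list_def)

lemma prod_list_var: "prod_list (map var w) = Poly_Mapping.single w (1 :: 'a::field)"
  by (induction w) (simp_all add: var_def mult_single plus_list_def single_Nil_1)

lemma of_int_times_single:
  "of_int k * Poly_Mapping.single w 1 = Poly_Mapping.single w (of_int k :: 'a::field)"
  for w :: "'x list"
proof -
  have "(of_int k :: 'x list \<Rightarrow>\<^sub>0 'a) = Poly_Mapping.single [] (of_int k)"
    by (simp flip: zero_list_def)
  then show ?thesis by (simp add: mult_single plus_list_def)
qed

lemma alt_var: "alt (map var zs) = signed_words {\<sigma>. \<sigma> permutes {..<length zs}} zs"
  unfolding alt_def signed_words_def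
  by (intro sum.cong) (simp_all add: permute_list_map prod_list_var of_int_times_single)

lemma K_elt_signed_words:
  "K_elt n i = - ((-1) ^ (n div 2)) * signed_words (V_perms n i) (omit n i)"
  unfolding K_elt_def signed_words_def
  by (intro arg_cong2[of _ _ _ _ "(*)"] sum.cong) (simp_all add: prod_list_var of_int_times_single)

lemma permute_list_inj:
  assumes "distinct zs" "\<sigma> permutes {..<length zs}" "\<tau> permutes {..<length zs}"
    and eq: "permute_list \<sigma> zs = permute_list \<tau> zs"
  shows "\<sigma> = \<tau>"
proof
  fix k
  show "\<sigma> k = \<tau> k"
  proof (cases "k < length zs")
    case True
    then have "zs ! \<sigma> k = zs ! \<tau> k" using eq permute_list_nth assms by metis
    then show ?thesis using True assms
      by (metis lessThan_iff nth_eq_iff_index_eq permutes_in_image)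
  qed (use assms in \<open>simp add: permutes_def\<close>)
qed

text \<open>Letters being distinct, different permutations give different words; no cancellation
  occurs, in any characteristic, because signs are units.\<close>

lemma keys_signed_words:
  assumes "distinct zs" "S \<subseteq> {\<sigma>. \<sigma> permutes {..<length zs}}"
  shows "Poly_Mapping.keys (signed_words S zs :: 'x list \<Rightarrow>\<^sub>0 'a::field) =
    (\<lambda>\<sigma>. permute_list \<sigma> zs) ` S"
proof -
  have fin: "finite S" using assms(2) by (rule finite_subset) (simp add: finite_permutations)
  have coeff: "Poly_Mapping.lookup (signed_words S zs :: 'x list \<Rightarrow>\<^sub>0 'a) (permute_list \<tau> zs) = of_int (sign \<tau>)"
    if "\<tau> \<in> S" for \<tau>
  proof -
    have "(permute_list \<sigma> zs = permute_list \<tau> zs) = (\<sigma> = \<tau>)" if "\<sigma> \<in> S" for \<sigma>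
      using permute_list_inj[OF assms(1), of \<sigma> \<tau>] that \<open>\<tau> \<in> S\<close> assms(2) by auto
    then have "Poly_Mapping.lookup (signed_words S zs :: 'x list \<Rightarrow>\<^sub>0 'a) (permute_list \<tau> zs) =
      (\<Sum>\<sigma>\<in>S. if \<sigma> = \<tau> then of_int (sign \<sigma>) else 0)"
      unfolding signed_words_def lookup_sum
      by (intro sum.cong) (auto simp: lookup_single when_def)
    then show ?thesis using fin that by simp
  qed
  have nz: "(of_int (sign \<tau>) :: 'a) \<noteq> 0" for \<tau> :: "nat \<Rightarrow> nat" by (simp add: sign_def)
  show ?thesis
  proof
    show "Poly_Mapping.keys (signed_words S zs :: 'x list \<Rightarrow>\<^sub>0 'a) \<subseteq> (\<lambda>\<sigma>. permute_list \<sigma> zs) ` S"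
    proof
      fix w assume "w \<in> Poly_Mapping.keys (signed_words S zs :: 'x list \<Rightarrow>\<^sub>0 'a)"
      then have "(\<Sum>\<sigma>\<in>S. Poly_Mapping.lookup (Poly_Mapping.single (permute_list \<sigma> zs) (of_int (sign \<sigma>) :: 'a)) w) \<noteq> 0"
        by (simp add: in_keys_iff signed_words_def lookup_sum)
      then obtain \<sigma> where "\<sigma> \<in> S" "Poly_Mapping.lookup (Poly_Mapping.single (permute_list \<sigma> zs) (of_int (sign \<sigma>) :: 'a)) w \<noteq> 0"
        by (rule sum.not_neutral_contains_not_neutral)
      then show "w \<in> (\<lambda>\<sigma>. permute_list \<sigma> zs) ` S" by (auto simp: lookup_single when_def split: if_splits)
    qed
  qed (use coeff nz in \<open>auto simp: in_keys_iff\<close>)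
qed

lemma arrangements_eq:
  "(\<lambda>\<sigma>. permute_list \<sigma> zs) ` {\<sigma>. \<sigma> permutes {..<length zs} \<and> P (permute_list \<sigma> zs)} =
    {w. mset w = mset zs \<and> P w}"
  by (auto elim!: mset_eq_permutation[of _ zs])

lemma sublist_pair_swap:
  assumes "w = u @ [a, b] @ v" "distinct w"
  shows "map (Transposition.transpose a b) w = u @ [b, a] @ v"
proof -
  have "map (Transposition.transpose a b) u = u" "map (Transposition.transpose a b) v = v"
    using assms by (auto intro!: map_idI simp: Transposition.transpose_def)
  then show ?thesis using assms(1) by simp
qed

text \<open>Exchanging the two adjacent letters pairs off these arrangements with opposite signs, and
  each pair is a multiple of the commutator of the two letters.\<close>

lemma signed_words_adjacent:
  fixes a b :: "'x::linorder"
  assumes dist: "distinct (a # b # r)" and "a < b"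
  shows "signed_words {\<sigma>. \<sigma> permutes {..<length (a # b # r)} \<and> adjacent a b (permute_list \<sigma> (a # b # r))} (a # b # r)
    \<in> combs {Poly_Mapping.single [b, a] (1 :: 'a::field) - Poly_Mapping.single [a, b] 1}
        {w. mset w = mset (a # b # r)}"
proof -
  let ?zs = "a # b # r"
  let ?N = "Poly_Mapping.single [b, a] (1 :: 'a) - Poly_Mapping.single [a, b] 1"
  let ?P = "\<lambda>\<sigma>. \<sigma> permutes {..<length ?zs}"
  let ?w = "\<lambda>\<sigma>. permute_list \<sigma> ?zs"
  let ?f = "\<lambda>\<sigma>. Poly_Mapping.single (?w \<sigma>) (of_int (sign \<sigma>) :: 'a)"
  \<comment> \<open>Composing with a transposition on the left exchanges the letters at positions 0 and 1 of the
    original list, here \<open>a\<close> and \<open>b\<close>, wherever they stand; so one fixed involution does the pairing.\<close>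
  let ?t = "Transposition.transpose 0 (1::nat)"
  define A where "A = {\<sigma>. ?P \<sigma> \<and> sublist [b, a] (?w \<sigma>)}"
  define B where "B = {\<sigma>. ?P \<sigma> \<and> sublist [a, b] (?w \<sigma>)}"
  have tP: "?P ?t" by (rule permutes_swap_id) auto
  have comp: "?P (?t \<circ> \<sigma>)" if "?P \<sigma>" for \<sigma> using that tP by (rule permutes_compose)
  have tt: "?t \<circ> (?t \<circ> \<sigma>) = \<sigma>" for \<sigma> by (simp add: fun_eq_iff)
  have wt: "?w (?t \<circ> \<sigma>) = map (Transposition.transpose a b) (?w \<sigma>)" if "?P \<sigma>" for \<sigma>
  proof -
    have "?w (?t \<circ> \<sigma>) = permute_list \<sigma> (permute_list ?t ?zs)"
      by (rule permute_list_compose[OF that])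
    also have "permute_list ?t ?zs = map (Transposition.transpose a b) ?zs"
    proof (rule nth_equalityI)
      fix i assume "i < length (permute_list ?t ?zs)"
      then have i: "i < length ?zs" by simp
      have "permute_list ?t ?zs ! i = ?zs ! ?t i" by (rule permute_list_nth[OF tP i])
      also have "\<dots> = Transposition.transpose a b (?zs ! i)"
        using dist i
        by (cases i; cases "i - 1") (auto simp: Transposition.transpose_def dest: nth_mem)
      finally show "permute_list ?t ?zs ! i = map (Transposition.transpose a b) ?zs ! i"
        by (simp only: nth_map[OF i])
    qed simp
    also have "permute_list \<sigma> (map (Transposition.transpose a b) ?zs) =
        map (Transposition.transpose a b) (?w \<sigma>)"
      by (rule permute_list_map[OF that])
    finally show ?thesis .
  qed
  have dw: "distinct (?w \<sigma>)" if "?P \<sigma>" for \<sigma> using that dist by simp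
  have swapped: "?w (?t \<circ> \<sigma>) = u @ [y, x] @ v"
    if "?P \<sigma>" "?w \<sigma> = u @ [x, y] @ v" "(x, y) = (a, b) \<or> (x, y) = (b, a)" for \<sigma> u v x y
    using wt[OF that(1)] sublist_pair_swap[OF that(2) dw[OF that(1)]] that(3)
    by (auto simp: transpose_commute)
  have AB: "?t \<circ> \<sigma> \<in> B" if "\<sigma> \<in> A" for \<sigma>
  proof -
    from that obtain u v where "?P \<sigma>" "?w \<sigma> = u @ [b, a] @ v" by (auto simp: A_def sublist_def)
    then show ?thesis using swapped[of \<sigma> u b a v] comp unfolding B_def sublist_def by blast
  qed
  have BA: "?t \<circ> \<sigma> \<in> A" if "\<sigma> \<in> B" for \<sigma>
  proof -
    from that obtain u v where "?P \<sigma>" "?w \<sigma> = u @ [a, b] @ v" by (auto simp: B_def sublist_def)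
    then show ?thesis using swapped[of \<sigma> u a b v] comp unfolding A_def sublist_def by blast
  qed
  have bij: "B = (\<lambda>\<sigma>. ?t \<circ> \<sigma>) ` A"
  proof
    show "B \<subseteq> (\<lambda>\<sigma>. ?t \<circ> \<sigma>) ` A"
    proof
      fix \<sigma> assume "\<sigma> \<in> B"
      then show "\<sigma> \<in> (\<lambda>\<sigma>. ?t \<circ> \<sigma>) ` A" by (intro image_eqI[of _ _ "?t \<circ> \<sigma>"] BA tt[symmetric])
    qed
  qed (use AB in blast)
  have inj: "inj_on (\<lambda>\<sigma>. ?t \<circ> \<sigma>) A" by (rule inj_onI) (metis tt)
  have fin: "finite A" "finite B" unfolding A_def B_def
    by (auto intro: finite_subset[OF _ finite_permutations[of "{..<length ?zs}"]])
  have disj: "A \<inter> B = {}"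
  proof -
    have False if w: "?P \<sigma>" "?w \<sigma> = u @ [b, a] @ v" "?w \<sigma> = u' @ [a, b] @ v'" for \<sigma> u v u' v'
    proof -
      have "distinct (u @ [b, a] @ v)" using dw[OF w(1)] w(2) by simp
      then show False using w(2,3) append_Cons_eq_iff[of b u "a # v" "u' @ [a]" v'] by auto
    qed
    then show ?thesis unfolding A_def B_def sublist_def by fast
  qed
  have "{\<sigma>. ?P \<sigma> \<and> adjacent a b (?w \<sigma>)} = A \<union> B" by (auto simp: adjacent_def A_def B_def)
  then have "signed_words {\<sigma>. ?P \<sigma> \<and> adjacent a b (?w \<sigma>)} ?zs = sum ?f A + sum ?f B"
    unfolding signed_words_def using sum.union_disjoint[OF fin disj] by simp
  also have "\<dots> = (\<Sum>\<sigma>\<in>A. ?f \<sigma> + ?f (?t \<circ> \<sigma>))"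
    unfolding bij sum.distrib sum.reindex[OF inj] by (simp only: o_def[of ?f])
  also have "\<dots> \<in> combs {?N} {w. mset w = mset ?zs}"
  proof (rule combs_sum)
    fix \<sigma> assume "\<sigma> \<in> A"
    then obtain u v where \<sigma>: "?P \<sigma>" "?w \<sigma> = u @ [b, a] @ v" by (auto simp: A_def sublist_def)
    have "permutation \<sigma>" "permutation ?t"
      using \<sigma>(1) tP permutation_permutes finite_lessThan by blast+
    then have "sign (?t \<circ> \<sigma>) = - sign \<sigma>"
      using sign_compose[of ?t \<sigma>] sign_swap_id[of 0 "1::nat"] by simp
    moreover have "?w (?t \<circ> \<sigma>) = u @ [a, b] @ v"
      using swapped[OF \<sigma>] by simp
    ultimately have "?f \<sigma> + ?f (?t \<circ> \<sigma>) = framed (of_int (sign \<sigma>)) u ?N v"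
      using \<sigma>(2) by (simp add: framed_diff single_uminus)
    moreover have "LM ?N = [b, a]"
      using \<open>a < b\<close> by (intro LM_eqI) (auto simp: in_keys_iff lookup_minus lookup_single when_def
          Cons_le_Cons split: if_splits)
    moreover have "mset (u @ [b, a] @ v) = mset ?zs"
      using mset_permute_list[OF \<sigma>(1)] \<sigma>(2) by simp
    ultimately show "?f \<sigma> + ?f (?t \<circ> \<sigma>) \<in> combs {?N} {w. mset w = mset ?zs}"
      by (auto intro!: combs_framed)
  qed
  finally show ?thesis .
qed

lemma arrangement_le_descending:
  fixes w l :: "'x::linorder list"
  assumes "sorted_wrt (\<ge>) l" "mset w = mset l"
  shows "w \<le> l"
  using assms
proof (induction l arbitrary: w)
  case (Cons b l)
  then obtain a w' where w: "w = a # w'" by (cases w) auto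
  have "length w' = length l" using Cons.prems(2) w mset_eq_length by fastforce
  moreover have "a \<in> set (b # l)" using Cons.prems(2) w mset_eq_setD by (metis list.set_intros(1))
  then have "a \<le> b" using Cons.prems(1) by auto
  moreover have "w' \<le> l" if "a = b" using Cons w that by simp
  ultimately show ?case using w by (auto simp: Cons_le_Cons)
qed simp

text \<open>The greedy choice: take the largest letters first. The constraint is felt only in the last
  three places, where \<open>m\<close> has to stand between 1 and 2.\<close>

lemma nonadjacent_arrangement_le:
  fixes w d :: "nat list"
  assumes "sorted_wrt (\<ge>) d" "\<And>k. k \<in> set d \<Longrightarrow> m \<le> k" "2 < m"
    and "mset w = mset (d @ [2, m, 1])" "\<not> adjacent 1 2 w"
  shows "w \<le> d @ [2, m, 1]"
  using assms
proof (induction d arbitrary: w)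
  case Nil
  then have "length w = 3" using mset_eq_length by fastforce
  then obtain x y z where w: "w = [x, y, z]"
    by (auto simp: length_Suc_conv numeral_3_eq_3)
  have xyz: "{#x, y, z#} = {#2, m, 1#}" using Nil.prems(4) w by simp
  have set: "{x, y, z} = {2, m, 1}" using arg_cong[OF xyz, of set_mset] by simp
  have "\<not> (x = 1 \<and> y = 2)" "\<not> (x = 2 \<and> y = 1)" "\<not> (y = 1 \<and> z = 2)" "\<not> (y = 2 \<and> z = 1)"
    using Nil.prems(5) by (auto simp: w adjacent_def sublist_Cons_right)
  moreover have "x \<in> {2, m, 1}" "y \<in> {2, m, 1}" "z \<in> {2, m, 1}"
    unfolding set[symmetric] by simp_all
  moreover have "1 \<in> {x, y, z}" "2 \<in> {x, y, z}" "m \<in> {x, y, z}"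
    unfolding set by simp_all
  ultimately have "[x, y, z] = [2, m, 1] \<or> [x, y, z] = [1, m, 2]"
    using Nil.prems(3) by auto
  then show ?case by (auto simp: w Cons_le_Cons)
next
  case (Cons b d)
  then obtain a w' where w: "w = a # w'" by (cases w) auto
  have "length w' = length (d @ [2, m, 1])" using Cons.prems(4) w mset_eq_length by fastforce
  moreover have "a \<in> set (b # d @ [2, m, 1])"
    using Cons.prems(4) w mset_eq_setD by (metis append_Cons list.set_intros(1))
  then have "a \<le> b" using Cons.prems(1-3) by force
  moreover have "w' \<le> d @ [2, m, 1]" if "a = b"
  proof (rule Cons.IH)
    show "\<not> adjacent 1 2 w'" using Cons.prems(5) w by (auto simp: adjacent_def sublist_Cons_right)
  qed (use Cons.prems w that in auto)
  ultimately show ?case using w by (auto simp: Cons_le_Cons)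
qed

section \<open>Leading words of the generators\<close>

lemma neg_one_power_times: "(-1) ^ k * p = framed ((-1) ^ k) [] p []"
  by (cases "even k") (simp_all add: framed_minus_coeff)

lemma keys_scaled: "c \<noteq> 0 \<Longrightarrow> Poly_Mapping.keys (framed c [] p []) = Poly_Mapping.keys p"
  using lookup_framed[of c "[]" p "[]"] by (auto simp: in_keys_iff)

lemma shorter_less: "length u < length v \<Longrightarrow> u < (v :: 'x::linorder list)"
  by (simp add: list_less_def lenlex_conv)

lemma distinct_append_Cons_eq:
  assumes "xs @ x # ys = us @ x # vs" "distinct (xs @ x # ys)"
  shows "xs = us \<and> ys = vs"
proof -
  have "x \<notin> set xs" "x \<notin> set ys" using assms(2) by auto
  then show ?thesis using append_Cons_eq_iff[of x xs ys us vs] assms(1) by blast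
qed

lemma var_times: "var i * p = framed 1 [i] p []"
  by (simp add: var_def framed_def single_Nil_1)

lemma times_var: "p * var i = framed 1 [] p [i]"
  by (simp add: var_def framed_def single_Nil_1)

lemma const_times: "const c * p = framed c [] p []"
  by (simp add: const_def framed_def single_Nil_1)

lemma N_elt_eq: "N_elt = Poly_Mapping.single [2, 1] 1 - Poly_Mapping.single [1, 2] 1"
  by (simp add: N_elt_def var_def mult_single plus_list_def)

lemma keys_N: "Poly_Mapping.keys (N_elt :: nat list \<Rightarrow>\<^sub>0 'a::field) = {[2, 1], [1, 2]}"
  by (auto simp: N_elt_eq in_keys_iff lookup_minus lookup_single when_def split: if_splits)

lemma LM_N: "LM (N_elt :: nat list \<Rightarrow>\<^sub>0 'a::field) = [2, 1]"
  by (intro LM_eqI) (auto simp: keys_N Cons_le_Cons)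

lemma set_omit: "set (omit n i) = {1..n + 1} - {i}"
  by (auto simp: omit_def simp del: upt_Suc)

lemma sorted_omit: "sorted_wrt (<) (omit n i)"
  unfolding omit_def by (rule sorted_wrt_filter) (simp del: upt_Suc)

lemma distinct_omit: "distinct (omit n i)"
  unfolding omit_def by (rule distinct_filter) (simp del: upt_Suc)

lemma length_omit: "i \<in> {1..n + 1} \<Longrightarrow> length (omit n i) = n"
  using distinct_card[OF distinct_omit[of n i]] by (simp add: set_omit)

lemma mset_omit:
  assumes "i \<in> {1..n + 1}"
  shows "add_mset i (mset (omit n i)) = mset [1..<n + 2]"
proof -
  have "mset (omit n i) = mset_set ({1..n + 1} - {i})"
    using mset_set_set[OF distinct_omit[of n i]] by (simp add: set_omit)
  moreover have "mset [1..<n + 2] = mset_set {1..n + 1}"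
    using mset_set_set[OF distinct_upt[of 1 "n + 2"]]
    by (simp add: atLeastLessThanSuc_atLeastAtMost del: upt_Suc)
  ultimately show ?thesis using assms mset_set.remove[of "{1..n + 1}" i] by simp
qed

lemma upt_1_split: "2 \<le> n \<Longrightarrow> [1..<n + 2] = 1 # 2 # [3..<n + 2]"
  by (simp add: upt_conv_Cons numeral_3_eq_3 numeral_2_eq_2 del: upt_Suc)

lemma omit_1: "2 \<le> n \<Longrightarrow> omit n 1 = 2 # [3..<n + 2]"
  unfolding omit_def by (subst upt_1_split) (auto intro!: filter_True simp del: upt_Suc)

lemma omit_2: "2 \<le> n \<Longrightarrow> omit n 2 = 1 # [3..<n + 2]"
  unfolding omit_def by (subst upt_1_split) (auto intro!: filter_True simp del: upt_Suc)

lemma omit_ge_3: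
  assumes "4 \<le> n" "i \<in> {3..n + 1}"
  obtains m r where "omit n i = 1 # 2 # m # r" "r \<noteq> []" "3 \<le> m" "\<And>k. k \<in> set r \<Longrightarrow> m < k"
proof -
  let ?l = "filter (\<lambda>j. j \<noteq> i) [3..<n + 2]"
  have o: "omit n i = 1 # 2 # ?l"
    unfolding omit_def using assms by (subst upt_1_split) (auto simp del: upt_Suc)
  then have "length ?l \<ge> 2" using length_omit[of i n] assms by simp
  then obtain m r where l: "?l = m # r" "r \<noteq> []"
    by (cases ?l; cases "tl ?l") auto
  have "m \<in> set ?l" using l by simp
  then have "3 \<le> m" by (simp del: upt_Suc)
  moreover have "sorted_wrt (<) (m # r)"
    using sorted_omit[of n i] o l by simp
  ultimately show ?thesis using that o l by auto
qed

text \<open>The polynomial \<open>h\<close> stands for the tail of lower degree, which cannot interfere at the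
  descending word.\<close>

lemma LM_alt_minus:
  fixes h :: "nat list \<Rightarrow>\<^sub>0 'a::field"
  assumes sorted: "sorted_wrt (<) zs" and h: "\<And>k. k \<in> Poly_Mapping.keys h \<Longrightarrow> length k < length zs"
    and "c \<noteq> 0"
  shows "framed c [] (alt (map var zs) - h) [] \<noteq> 0"
    and "LM (framed c [] (alt (map var zs) - h) []) = rev zs"
proof -
  let ?A = "alt (map var zs) :: nat list \<Rightarrow>\<^sub>0 'a"
  let ?f = "framed c [] (?A - h) []"
  have dist: "distinct zs" using sorted strict_sorted_iff by auto
  have A: "Poly_Mapping.keys ?A = {w. mset w = mset zs}"
    using arrangements_eq[of zs "\<lambda>_. True"] by (simp add: alt_var keys_signed_words[OF dist])
  have f: "Poly_Mapping.keys ?f = Poly_Mapping.keys (?A - h)"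
    using \<open>c \<noteq> 0\<close> by (rule keys_scaled)
  have "rev zs \<notin> Poly_Mapping.keys h" using h[of "rev zs"] by auto
  moreover have "rev zs \<in> Poly_Mapping.keys ?A" by (simp add: A)
  ultimately have top: "rev zs \<in> Poly_Mapping.keys ?f"
    unfolding f by (simp add: in_keys_iff lookup_minus)
  have "w \<le> rev zs" if "mset w = mset zs" for w
    using that sorted by (intro arrangement_le_descending)
      (auto simp: sorted_wrt_rev intro: sorted_wrt_mono_rel[of _ "(<)"])
  moreover have "w \<le> rev zs" if "w \<in> Poly_Mapping.keys h" for w
    using h[OF that] shorter_less[of w "rev zs"] by simp
  ultimately have "Poly_Mapping.keys ?f \<subseteq> {..rev zs}"
    unfolding f using keys_diff[of ?A h] A by blast
  then show "LM ?f = rev zs" using top by (intro LM_eqI)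
  show "?f \<noteq> 0" using top by auto
qed

text \<open>The bracket of the basis vectors $e_j$, $j \neq i$, in increasing order, with letters in place
  of basis vectors.\<close>

definition G_tail :: "'a::field \<Rightarrow> nat \<Rightarrow> nat list \<Rightarrow>\<^sub>0 'a" where
  "G_tail \<beta> i = (if i = 1 then var 1 + const \<beta> * var 2 else if i = 2 then var 2 else 0)"

lemma G_elt_eq: "G_elt n \<beta> i = framed ((-1) ^ (n div 2)) [] (alt (map var (omit n i)) - G_tail \<beta> i) []"
  unfolding G_elt_def G_tail_def neg_one_power_times by simp

lemma keys_G_tail: "Poly_Mapping.keys (G_tail \<beta> i) \<subseteq> {[1], [2]}"
proof -
  have "G_tail \<beta> i = (if i = 1 then Poly_Mapping.single [1] 1 + Poly_Mapping.single [2] \<beta> else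
      if i = 2 then Poly_Mapping.single [2] 1 else 0)"
    by (simp add: G_tail_def var_def const_def mult_single plus_list_def)
  then show ?thesis
    by (auto simp: in_keys_iff lookup_add lookup_single when_def split: if_splits)
qed

lemma LM_G:
  assumes "2 \<le> n" "i \<in> {1..n + 1}"
  shows "G_elt n \<beta> i \<noteq> 0" "LM (G_elt n \<beta> i) = rev (omit n i)"
proof -
  have h: "length k < length (omit n i)" if "k \<in> Poly_Mapping.keys (G_tail \<beta> i)" for k
    using keys_G_tail[of \<beta> i] that assms length_omit[of i n] by auto
  show "G_elt n \<beta> i \<noteq> 0"
    unfolding G_elt_eq by (rule LM_alt_minus(1)[OF sorted_omit h]) simp_all
  show "LM (G_elt n \<beta> i) = rev (omit n i)"
    unfolding G_elt_eq by (rule LM_alt_minus(2)[OF sorted_omit h]) simp_all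
qed

lemma K_elt_eq: "K_elt n i = framed (- ((-1) ^ (n div 2))) [] (signed_words (V_perms n i) (omit n i)) []"
  unfolding K_elt_signed_words framed_minus_coeff by (simp add: neg_one_power_times)

lemma keys_K:
  assumes "i \<in> {1..n + 1}"
  shows "Poly_Mapping.keys (K_elt n i :: nat list \<Rightarrow>\<^sub>0 'a::field) =
    {w. mset w = mset (omit n i) \<and> \<not> adjacent 1 2 w}"
proof -
  have V: "V_perms n i = {\<sigma>. \<sigma> permutes {..<length (omit n i)} \<and> \<not> adjacent 1 2 (permute_list \<sigma> (omit n i))}"
    using assms by (simp add: V_perms_def length_omit)
  have "Poly_Mapping.keys (K_elt n i :: nat list \<Rightarrow>\<^sub>0 'a) =
      (\<lambda>\<sigma>. permute_list \<sigma> (omit n i)) ` V_perms n i"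
    unfolding K_elt_eq by (subst keys_scaled, simp, subst keys_signed_words) (auto simp: V distinct_omit)
  also have "\<dots> = {w. mset w = mset (omit n i) \<and> \<not> adjacent 1 2 w}"
    unfolding V by (rule arrangements_eq)
  finally show ?thesis .
qed

lemma not_adjacent_top:
  assumes "distinct (d @ [2, m, 1])"
  shows "\<not> adjacent 1 2 (d @ [2, m, 1 :: nat])"
proof
  assume "adjacent 1 2 (d @ [2, m, 1])"
  then consider u v where "d @ [2, m, 1] = u @ [1, 2] @ v" | u v where "d @ [2, m, 1] = u @ [2, 1] @ v"
    unfolding adjacent_def sublist_def by blast
  then show False
  proof cases
    case (1 u v)
    then have "(d @ [2, m]) @ 1 # [] = u @ 1 # (2 # v)" by simp
    from distinct_append_Cons_eq[OF this] show False using assms by simp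
  next
    case (2 u v)
    then have "d @ 2 # [m, 1] = u @ 2 # (1 # v)" by simp
    from distinct_append_Cons_eq[OF this] show False using assms by simp
  qed
qed

lemma LM_K:
  assumes i: "i \<in> {3..n + 1}" and o: "omit n i = 1 # 2 # m # r" and m: "3 \<le> m"
  shows "(K_elt n i :: nat list \<Rightarrow>\<^sub>0 'a::field) \<noteq> 0"
    and "LM (K_elt n i :: nat list \<Rightarrow>\<^sub>0 'a::field) = rev r @ [2, m, 1]"
proof -
  let ?K = "K_elt n i :: nat list \<Rightarrow>\<^sub>0 'a" and ?w = "rev r @ [2, m, 1]"
  have "distinct ?w" using distinct_omit[of n i] o by auto
  then have top: "?w \<in> Poly_Mapping.keys ?K"
    using i not_adjacent_top[of "rev r" m] o by (subst keys_K) auto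
  have sorted: "sorted_wrt (<) (m # r)" using sorted_omit[of n i] o by simp
  have "w \<le> ?w" if "mset w = mset (omit n i)" "\<not> adjacent 1 2 w" for w
    using that m sorted o by (intro nonadjacent_arrangement_le)
      (auto simp: sorted_wrt_rev intro: sorted_wrt_mono_rel[of _ "(<)"])
  then have "Poly_Mapping.keys ?K \<subseteq> {..?w}" using i by (subst keys_K) auto
  then show "LM ?K = ?w" using top by (intro LM_eqI)
  show "?K \<noteq> 0" using top by auto
qed

section \<open>Overlaps of leading words\<close>

definition G_basis :: "nat \<Rightarrow> 'a::field \<Rightarrow> (nat list \<Rightarrow>\<^sub>0 'a) set" where
  "G_basis n \<beta> = {G_elt n \<beta> 1, G_elt n \<beta> 2} \<union> K_elt n ` {3..n + 1} \<union> {N_elt}"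

text \<open>For \<open>K_elt n i\<close> the increasing list \<open>m # r\<close> of its letters above 2 has at least two entries
  because \<open>n \<ge> 4\<close>. So \<open>r\<close> is nonempty, and its letters exceed \<open>m\<close> and thus 3; this is what
  rules out overlaps of \<open>G_elt n \<beta> 1\<close> with \<open>K_elt n i\<close> below.\<close>

lemma G_basis_cases [consumes 2, case_names G1 G2 K N]:
  assumes "4 \<le> n" "g \<in> G_basis n \<beta>"
  obtains "g = G_elt n \<beta> 1" "LM g = rev [3..<n + 2] @ [2]"
    | "g = G_elt n \<beta> 2" "LM g = rev [3..<n + 2] @ [1]"
    | i m r where "i \<in> {3..n + 1}" "g = K_elt n i" "omit n i = 1 # 2 # m # r" "r \<noteq> []" "3 \<le> m"
        "\<And>k. k \<in> set r \<Longrightarrow> 3 < k" "LM g = rev r @ [2, m, 1]" "distinct (rev r @ [2, m, 1])"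
    | "g = N_elt" "LM g = [2, 1]"
proof -
  consider "g = G_elt n \<beta> 1" | "g = G_elt n \<beta> 2" | i where "i \<in> {3..n + 1}" "g = K_elt n i" | "g = N_elt"
    using assms(2) by (auto simp: G_basis_def)
  then show ?thesis
  proof cases
    case 1
    then show ?thesis using that(1) LM_G(2)[of n 1 \<beta>] assms(1) omit_1[of n] by simp
  next
    case 2
    then show ?thesis using that(2) LM_G(2)[of n 2 \<beta>] assms(1) omit_2[of n] by simp
  next
    case 3
    obtain m r where o: "omit n i = 1 # 2 # m # r" "r \<noteq> []" "3 \<le> m" "\<And>k. k \<in> set r \<Longrightarrow> m < k"
      using omit_ge_3[OF assms(1) 3(1)] by blast
    have "distinct (rev r @ [2, m, 1])" using distinct_omit[of n i] o(1) by auto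
    moreover have "3 < k" if "k \<in> set r" for k using o(3) o(4)[OF that] by simp
    ultimately show ?thesis using that(3)[OF 3 o(1-3)] LM_K(2)[OF 3(1) o(1,3)] 3(2) by blast
  next
    case 4
    then show ?thesis using that(4) LM_N by blast
  qed
qed

lemma zero_notin_G_basis:
  assumes "4 \<le> n"
  shows "0 \<notin> G_basis n \<beta>"
proof
  assume "0 \<in> G_basis n \<beta>"
  then consider "G_elt n \<beta> 1 = 0" | "G_elt n \<beta> 2 = 0" | i where "i \<in> {3..n + 1}" "K_elt n i = (0 :: nat list \<Rightarrow>\<^sub>0 'a)"
    | "N_elt = (0 :: nat list \<Rightarrow>\<^sub>0 'a)"
    by (auto simp: G_basis_def)
  then show False
  proof cases
    case (3 i)
    then show False using omit_ge_3[OF assms 3(1)] LM_K(1)[OF 3(1)] by metis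
  next
    case 4
    then show False using keys_N[where ?'a = 'a] by auto
  qed (use LM_G(1)[of n 1 \<beta>] LM_G(1)[of n 2 \<beta>] assms in auto)
qed

lemma LM_G_basis_sublist:
  assumes n: "4 \<le> n" and g: "g \<in> G_basis n \<beta>" and g': "g' \<in> G_basis n \<beta>"
    and sub: "sublist (LM g') (LM g)"
  shows "g = g'"
proof -
  have LM_N': "LM (N_elt :: nat list \<Rightarrow>\<^sub>0 'a) = [2, 1]" by (rule LM_N)
  have len: "length (LM h) = n \<or> h = N_elt" if "h \<in> G_basis n \<beta>" for h
    using n that
  proof (cases rule: G_basis_cases)
    case G1
    have "length (LM h) = n" unfolding G1(2) using n by (simp del: upt_Suc)
    then show ?thesis by blast
  next
    case G2
    have "length (LM h) = n" unfolding G2(2) using n by (simp del: upt_Suc)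
    then show ?thesis by blast
  next
    case (K i m r)
    have "length (LM h) = length (omit n i)" unfolding K(3,7) by simp
    also have "\<dots> = n" using K(1) by (intro length_omit) simp
    finally show ?thesis by blast
  qed blast
  have noN: "\<not> sublist [2, 1] (LM g)" if "g \<noteq> N_elt"
    using n g
  proof (cases rule: G_basis_cases)
    case G1
    have "1 \<notin> set (LM g)" unfolding G1(2) by (simp del: upt_Suc)
    then show ?thesis using set_mono_sublist[of "[2, 1]" "LM g"] by force
  next
    case G2
    have "2 \<notin> set (LM g)" unfolding G2(2) by (simp del: upt_Suc)
    then show ?thesis using set_mono_sublist[of "[2, 1]" "LM g"] by force
  next
    case (K i m r)
    show ?thesis using not_adjacent_top[OF K(8)] unfolding K(7) adjacent_def by blast
  next
    case N
    then show ?thesis using that by blast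
  qed
  show ?thesis
  proof (cases "g = N_elt \<or> g' = N_elt")
    case True
    then show ?thesis
    proof (cases "g = N_elt")
      case True
      then have "length (LM g) = 2" using LM_N' by simp
      then have "length (LM g') \<noteq> n" using sublist_length_le[OF sub] n by linarith
      then have "g' = N_elt" using len[OF g'] by blast
      with True show ?thesis by simp
    next
      case False
      then have "g' = N_elt" using \<open>g = N_elt \<or> g' = N_elt\<close> by blast
      then have "sublist [2, 1] (LM g)" using sub LM_N' by simp
      then show ?thesis using noN[OF False] by blast
    qed
  next
    case False
    then have "length (LM g) = n" "length (LM g') = n" using len[OF g] len[OF g'] by blast+
    moreover obtain ps ss where "LM g = ps @ LM g' @ ss" using sub unfolding sublist_def by blast
    ultimately have eq: "LM g' = LM g" by simp
    from n g show ?thesis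
    proof (cases rule: G_basis_cases)
      case G1
      have last: "last (LM g') = 2" unfolding eq G1(2) by simp
      from n g' show ?thesis
      proof (cases rule: G_basis_cases)
        case G1': G1
        then show ?thesis using G1(1) by simp
      next
        case G2
        then show ?thesis using last by simp
      next
        case (K i m r)
        then show ?thesis using last by simp
      next
        case N
        then show ?thesis using False by blast
      qed
    next
      case G2
      have no2: "2 \<notin> set (LM g')" unfolding eq G2(2) by (simp del: upt_Suc)
      from n g' show ?thesis
      proof (cases rule: G_basis_cases)
        case G1
        then show ?thesis using no2 by simp
      next
        case G2': G2
        then show ?thesis using G2(1) by simp
      next
        case (K i m r)
        then show ?thesis using no2 by simp
      next
        case N
        then show ?thesis using False by blast
      qed
    next
      case (K i m r)
      have 12: "1 \<in> set (LM g')" "2 \<in> set (LM g')" unfolding eq K(7) by simp_all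
      from n g' show ?thesis
      proof (cases rule: G_basis_cases)
        case G1
        have "1 \<notin> set (LM g')" unfolding G1(2) by (simp del: upt_Suc)
        then show ?thesis using 12 by blast
      next
        case G2
        have "2 \<notin> set (LM g')" unfolding G2(2) by (simp del: upt_Suc)
        then show ?thesis using 12 by blast
      next
        case K': (K i' m' r')
        have "r = r' \<and> m = m'" using K(7) K'(7) eq by simp
        then have "omit n i = omit n i'" using K(3) K'(3) by simp
        then have "{1..n + 1} - {i} = {1..n + 1} - {i'}" unfolding set_omit[symmetric] by (rule arg_cong)
        moreover have "i \<in> {1..n + 1}" using K(1) by simp
        ultimately have "i = i'" by blast
        then show ?thesis using K(2) K'(2) by simp
      next
        case N
        then show ?thesis using False by blast
      qed
    next
      case N
      then show ?thesis using False by blast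
    qed
  qed
qed

text \<open>The letter 1 occurs in leading words only at the end, so the first word of an overlap
  cannot end in 1; hence it is that of \<open>G_elt n \<beta> 1\<close>, and the shared part ends in 2. For \<open>K_elt n i\<close> the part
  up to 2 would have to be a suffix of $x_{n+1}\cdots x_3x_2$, but its letter before 2 is above 3.\<close>

lemma G_basis_overlap:
  assumes n: "4 \<le> n" and g: "g \<in> G_basis n \<beta>" and g': "g' \<in> G_basis n \<beta>"
    and ab: "LM g = a @ b" and bd: "LM g' = b @ d" and ne: "b \<noteq> []" "d \<noteq> []"
  shows "g = G_elt n \<beta> 1 \<and> g' = N_elt \<and> a = rev [3..<n + 2] \<and> d = [1]"
proof -
  have "1 \<notin> set (butlast (LM g'))"
    using n g' by (cases rule: G_basis_cases) (auto simp: butlast_append simp del: upt_Suc)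
  then have b1: "1 \<notin> set b" using bd ne by (simp add: butlast_append)
  have last: "last (LM g) = last b" using ab ne by simp
  then have "last (LM g) \<noteq> 1" using b1 ne last_in_set by metis
  with n g have g1: "g = G_elt n \<beta> 1" "LM g = rev [3..<n + 2] @ [2]"
    by (cases rule: G_basis_cases; simp)+
  then have "last b = 2" using last by simp
  then obtain b' where b': "b = b' @ [2]" using ne append_butlast_last_id[of b] by metis
  then have a: "a @ b' = rev [3..<n + 2]" using ab g1 by simp
  from n g' show ?thesis
  proof (cases rule: G_basis_cases)
    case G1
    then have "rev [3..<n + 2] @ 2 # [] = b' @ 2 # d" using bd b' by simp
    moreover have "distinct (rev [3..<n + 2] @ 2 # [])" by (simp del: upt_Suc)
    ultimately have "d = []" using distinct_append_Cons_eq by metis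
    then show ?thesis using ne by simp
  next
    case G2
    then have "2 \<in> set (LM g')" using bd b' by simp
    moreover have "2 \<notin> set (LM g')" unfolding G2(2) by (simp del: upt_Suc)
    ultimately show ?thesis by blast
  next
    case (K i m r)
    have "rev r @ 2 # [m, 1] = b' @ 2 # d" using K(7) bd b' by simp
    from distinct_append_Cons_eq[OF this] K(8) have br: "b' = rev r" by simp
    have "r @ rev a = [3..<n + 2]" using arg_cong[OF a, of rev] br by (simp del: upt_Suc)
    also have "[3..<n + 2] = 3 # [Suc 3..<n + 2]" using n by (intro upt_conv_Cons) simp
    finally have "3 \<in> set r" using K(4) by (cases r) auto
    then show ?thesis using K(6) by blast
  next
    case N
    then have "[] @ 2 # [1] = b' @ 2 # d" using bd b' by simp
    from distinct_append_Cons_eq[OF this] have "b' = []" "d = [1]" by simp_all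
    then show ?thesis using g1 N a by simp
  qed
qed

section \<open>The commutator identity and the only overlap\<close>

lemma G_plus_K:
  assumes "4 \<le> n" "i \<in> {3..n + 1}"
  shows "G_elt n \<beta> i + K_elt n i \<in> combs {N_elt} {w. mset w = mset (omit n i)}"
proof -
  let ?e = "(-1) ^ (n div 2) :: 'a"
  obtain m r where o: "omit n i = 1 # 2 # m # r" using omit_ge_3[OF assms] by blast
  let ?P = "\<lambda>\<sigma>. \<sigma> permutes {..<length (omit n i)}"
  let ?A = "\<lambda>\<sigma>. adjacent 1 2 (permute_list \<sigma> (omit n i))"
  have len: "length (omit n i) = n" using assms by (intro length_omit) simp
  have V: "V_perms n i = {\<sigma>. ?P \<sigma> \<and> \<not> ?A \<sigma>}" by (simp add: V_perms_def len)
  let ?S = "{\<sigma>. ?P \<sigma> \<and> ?A \<sigma>}"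
  have fin: "finite ?S" "finite (V_perms n i)" unfolding V
    by (rule finite_subset[OF _ finite_permutations[of "{..<length (omit n i)}"]], blast, simp)+
  have disj: "?S \<inter> V_perms n i = {}" unfolding V by blast
  have un: "{\<sigma>. ?P \<sigma>} = ?S \<union> V_perms n i" unfolding V by blast
  have split: "signed_words {\<sigma>. ?P \<sigma>} (omit n i) =
      signed_words ?S (omit n i) + (signed_words (V_perms n i) (omit n i) :: nat list \<Rightarrow>\<^sub>0 'a)"
    unfolding un unfolding signed_words_def by (rule sum.union_disjoint[OF fin disj])
  have "G_tail \<beta> i = 0" using assms by (simp add: G_tail_def)
  then have G: "G_elt n \<beta> i = framed ?e [] (signed_words {\<sigma>. ?P \<sigma>} (omit n i)) []"
    unfolding G_elt_eq alt_var by (simp only: diff_0_right)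
  have K: "K_elt n i = - framed ?e [] (signed_words (V_perms n i) (omit n i)) []"
    unfolding K_elt_eq framed_minus_coeff ..
  have eq: "G_elt n \<beta> i + K_elt n i = framed ?e [] (signed_words ?S (omit n i)) []"
    unfolding G K split framed_add by (simp only: add_uminus_conv_diff add_diff_cancel_right')
  have "distinct (1 # 2 # m # r)" using distinct_omit[of n i] unfolding o .
  then have "signed_words ?S (omit n i)
      \<in> combs {N_elt :: nat list \<Rightarrow>\<^sub>0 'a} {w. mset w = mset (omit n i)}"
    unfolding o N_elt_eq by (rule signed_words_adjacent) simp
  then show ?thesis unfolding eq by (rule combs_scale)
qed

lemma times_const: "p * const c = const c * p"
  unfolding const_times by (simp add: const_def times_single)

text \<open>The commutators with the alternating parts cancel by \<open>alt_commutator_sum\<close>. Of the tails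
  $x_1 + \beta x_2$ and $x_2$ only the product $\beta x_1 x_2$ has a nonzero commutator.\<close>

lemma commutator_identity:
  assumes "2 \<le> n" "even n"
  shows "(\<Sum>j<Suc n. (-1) ^ j * (var (Suc j) * G_elt n \<beta> (Suc j) - G_elt n \<beta> (Suc j) * var (Suc j))) =
    framed ((-1) ^ (n div 2) * \<beta>) [] N_elt []"
proof -
  let ?e = "(-1) ^ (n div 2) :: nat list \<Rightarrow>\<^sub>0 'a"
  let ?A = "\<lambda>j. alt (map var (omit n (Suc j))) :: nat list \<Rightarrow>\<^sub>0 'a"
  let ?h = "\<lambda>j. G_tail \<beta> (Suc j)"
  let ?c = "\<lambda>j p. (-1) ^ j * (var (Suc j) * p - p * var (Suc j)) :: nat list \<Rightarrow>\<^sub>0 'a"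
  have A: "(\<Sum>j<Suc n. ?c j (?A j)) = 0"
  proof -
    have "(\<Sum>j<Suc n. ?c j (?A j)) = (\<Sum>j<Suc n. (-1) ^ j *
        (map var [1..<n + 2] ! j * alt (drop_nth j (map var [1..<n + 2])) -
         alt (drop_nth j (map var [1..<n + 2])) * map var [1..<n + 2] ! j))"
    proof (rule sum.cong[OF refl])
      fix j assume "j \<in> {..<Suc n}"
      then have j: "j < Suc n" by simp
      have "map var [1..<n + 2] ! j = (var (Suc j) :: nat list \<Rightarrow>\<^sub>0 'a)"
        using j by (simp add: nth_map nth_upt del: upt_Suc)
      then show "?c j (?A j) = (-1) ^ j *
        (map var [1..<n + 2] ! j * alt (drop_nth j (map var [1..<n + 2])) -
         alt (drop_nth j (map var [1..<n + 2])) * map var [1..<n + 2] ! j)"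
        unfolding omit_as_drop_nth[OF j] drop_nth_map by simp
    qed
    also have "\<dots> = 0" using assms(2) by (intro alt_commutator_sum) (simp_all del: upt_Suc)
    finally show ?thesis .
  qed
  have h: "(\<Sum>j<Suc n. ?c j (?h j)) = - framed \<beta> [] N_elt []"
  proof -
    have "(\<Sum>j<Suc n. ?c j (?h j)) = (\<Sum>j\<in>{0, 1}. ?c j (?h j))"
      using assms(1) by (intro sum.mono_neutral_right) (auto simp: G_tail_def)
    also have "\<dots> = ?c 0 (?h 0) + ?c 1 (?h 1)" by simp
    also have "\<dots> = framed \<beta> [] (var 1 * var 2 - var 2 * var 1) []"
    proof -
      let ?x = "var 1 :: nat list \<Rightarrow>\<^sub>0 'a" and ?y = "var 2 :: nat list \<Rightarrow>\<^sub>0 'a"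
        and ?b = "const \<beta> :: nat list \<Rightarrow>\<^sub>0 'a"
      have "?x * (?b * ?y) = ?b * (?x * ?y)"
        unfolding mult.assoc[symmetric] times_const ..
      then have "?c 0 (?h 0) = ?b * (?x * ?y - ?y * ?x)"
        by (simp add: G_tail_def distrib_left distrib_right right_diff_distrib mult.assoc)
      moreover have "?c 1 (?h 1) = 0" by (simp add: G_tail_def numeral_2_eq_2)
      ultimately show ?thesis by (simp add: const_times)
    qed
    also have "var 1 * var 2 - var 2 * var 1 = - (N_elt :: nat list \<Rightarrow>\<^sub>0 'a)" by (simp add: N_elt_def)
    also have "framed \<beta> [] (- (N_elt :: nat list \<Rightarrow>\<^sub>0 'a)) [] = - framed \<beta> [] N_elt []"
      by (simp add: framed_def)
    finally show ?thesis .
  qed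
  have "?c j (G_elt n \<beta> (Suc j)) = ?e * (?c j (?A j) - ?c j (?h j))" for j
  proof -
    have G: "G_elt n \<beta> (Suc j) = ?e * (?A j - ?h j)" unfolding G_elt_eq neg_one_power_times ..
    show ?thesis unfolding G by (cases "even (n div 2)") (simp_all add: algebra_simps)
  qed
  then have "(\<Sum>j<Suc n. ?c j (G_elt n \<beta> (Suc j))) = ?e * (\<Sum>j<Suc n. ?c j (?A j) - ?c j (?h j))"
    by (simp only: sum_distrib_left)
  also have "\<dots> = ?e * framed \<beta> [] N_elt []" unfolding sum_subtractf A h by simp
  also have "\<dots> = framed ((-1) ^ (n div 2) * \<beta>) [] N_elt []" by (simp add: neg_one_power_times)
  finally show ?thesis .
qed

lemma arrangement_less_top:
  assumes "mset w = mset [1..<n + 2]" "w \<noteq> rev [1..<n + 2]"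
  shows "w < rev [1..<n + 2 :: nat]"
proof -
  have "sorted_wrt (\<ge>) (rev [1..<n + 2])"
    by (auto simp: sorted_wrt_rev intro: sorted_wrt_mono_rel[of _ "(<)"] simp del: upt_Suc)
  then have "w \<le> rev [1..<n + 2]" using assms(1) by (intro arrangement_le_descending) (simp_all del: upt_Suc)
  then show ?thesis using assms(2) by simp
qed

lemma rev_upt_1: "2 \<le> n \<Longrightarrow> rev [1..<n + 2] = rev [3..<n + 2] @ [2, 1]"
  by (subst upt_1_split) simp_all

lemma no_overlap_N:
  assumes "g \<in> {N_elt :: nat list \<Rightarrow>\<^sub>0 'a::field}" "g' \<in> {N_elt}" "u @ LM g @ v = u' @ LM g' @ v'"
  shows "resolvable {N_elt} u g v u' g' v'"
proof (rule resolvable_if_overlaps)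
  show "g \<in> {N_elt}" "g' \<in> {N_elt}" "u @ LM g @ v = u' @ LM g' @ v'" by (fact assms)+
  have "Poly_Mapping.keys (N_elt :: nat list \<Rightarrow>\<^sub>0 'a) \<noteq> {}" unfolding keys_N by simp
  then show "0 \<notin> {N_elt :: nat list \<Rightarrow>\<^sub>0 'a}" by (metis keys_zero singletonD)
  fix g g' :: "nat list \<Rightarrow>\<^sub>0 'a" and a b d
  assume g: "g \<in> {N_elt}" "g' \<in> {N_elt}" and "LM g = a @ b" "LM g' = b @ d"
    and ne: "a \<noteq> []" "b \<noteq> []" "d \<noteq> []"
  then have eq: "a @ b = [2, 1]" "b @ d = [2, 1]" using LM_N[where ?'a = 'a] by simp_all
  from arg_cong[OF eq(1), of length] arg_cong[OF eq(2), of length]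
  have "length a + length b = 2" by simp
  moreover have "length a > 0" "length b > 0" using ne by simp_all
  ultimately have "length b = 1" by linarith
  then obtain y where y: "b = [y]" by (auto simp: length_Suc_conv)
  from arg_cong[OF eq(1), of last] arg_cong[OF eq(2), of hd] have False unfolding y by simp
  then show "resolvable {N_elt} [] g d a g' []" ..
next
  fix g g' :: "nat list \<Rightarrow>\<^sub>0 'a"
  assume "g \<in> {N_elt}" "g' \<in> {N_elt}"
  then show "g = g'" by simp
qed

text \<open>In the commutator identity every \<open>G_elt n \<beta> i\<close> with \<open>i \<ge> 3\<close> is replaced by
  \<open>- K_elt n i\<close> plus a combination \<open>q i\<close> of multiples of \<open>N_elt\<close>. All words of degree \<open>n + 1\<close> are
  arrangements of all letters, and the descending word \<open>top\<close>, which is the overlap, is the largest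
  of them. It starts with \<open>n + 1\<close> and ends in 2, 1, so among the terms apart from $G_1x_1$ it
  can be the leading word only in a product $x_i q_i$.\<close>

lemma overlap_resolvable:
  fixes \<beta> :: "'a::field"
  assumes n: "4 \<le> n" "even n"
  shows "resolvable (G_basis n \<beta>) [] (G_elt n \<beta> 1) [1] (rev [3..<n + 2]) N_elt []"
proof -
  define top where "top = rev [1..<n + 2]"
  define desc where "desc = rev [3..<n + 2]"
  let ?B = "G_basis n \<beta>"
  let ?N = "N_elt :: nat list \<Rightarrow>\<^sub>0 'a" and ?G = "G_elt n \<beta>" and ?K = "K_elt n :: nat \<Rightarrow> nat list \<Rightarrow>\<^sub>0 'a"
  let ?e = "(-1) ^ (n div 2) * \<beta>"
  have w: "top = desc @ [2, 1]" unfolding top_def desc_def using n by (intro rev_upt_1) simp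
  have hd_w: "hd top = n + 1" by (simp add: top_def)
  have dist: "distinct (desc @ 2 # [1])" by (simp add: desc_def del: upt_Suc)
  have last_w: "last top = 1" unfolding w by simp
  have B: "?G 1 \<in> ?B" "?G 2 \<in> ?B" "?N \<in> ?B" "\<And>i. i \<in> {3..n + 1} \<Longrightarrow> ?K i \<in> ?B"
    by (auto simp: G_basis_def)
  have LM_G': "mset (LM (?G i)) = mset (omit n i)" if "i \<in> {1..n + 1}" for i
    using n that by (subst LM_G) auto
  have left_le: "i # u \<in> {..top}" and left_less: "i # u \<noteq> top \<Longrightarrow> i # u \<in> {..<top}"
    and right_less: "i \<noteq> 1 \<Longrightarrow> u @ [i] \<in> {..<top}"
    if "mset u = mset (omit n i)" "i \<in> {1..n + 1}" for i u
  proof -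
    have m: "mset (i # u) = mset [1..<n + 2]" "mset (u @ [i]) = mset [1..<n + 2]"
      using mset_omit[OF that(2)] that(1) by simp_all
    show less: "i # u \<noteq> top \<Longrightarrow> i # u \<in> {..<top}" using arrangement_less_top[OF m(1)] unfolding top_def by blast
    then show "i # u \<in> {..top}" by (cases "i # u = top") simp_all
    assume "i \<noteq> 1"
    then have "u @ [i] \<noteq> top" using last_w by (metis last_snoc)
    then show "u @ [i] \<in> {..<top}" using arrangement_less_top[OF m(2)] unfolding top_def by blast
  qed
  have x1: "var 1 * ?G 1 \<in> combs ?B {..<top}"
  proof -
    have "1 # LM (?G 1) \<noteq> top" using hd_w n by auto
    then have "1 # LM (?G 1) \<in> {..<top}" by (intro left_less LM_G') simp_all
    then show ?thesis unfolding var_times using B(1) by (intro combs_framed) simp_all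
  qed
  have x2: "var 2 * ?G 2 \<in> combs ?B {..<top}"
  proof -
    have "2 # LM (?G 2) \<noteq> top" using hd_w n by auto
    then have "2 # LM (?G 2) \<in> {..<top}" using n by (intro left_less LM_G') simp_all
    then show ?thesis unfolding var_times using B(2) by (intro combs_framed) simp_all
  qed
  have x2': "?G 2 * var 2 \<in> combs ?B {..<top}"
  proof -
    have "LM (?G 2) @ [2] \<in> {..<top}" using n by (intro right_less LM_G') simp_all
    then show ?thesis unfolding times_var using B(2) by (intro combs_framed) simp_all
  qed
  have eN: "framed ?e [] ?N [] \<in> combs ?B {..<top}"
  proof -
    have "[2, 1] < top" using n by (intro shorter_less) (simp add: top_def del: upt_Suc)
    then show ?thesis using B(3) LM_N[where ?'a = 'a] by (intro combs_framed) simp_all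
  qed
  \<comment> \<open>\<open>Q\<close> collects the products that may reach \<open>top\<close>, and \<open>D\<close> those that stay below it.\<close>
  define q where "q i = ?G i + ?K i" for i
  define R where "R = {2..<Suc n}"
  define Q where "Q = (\<Sum>j\<in>R. (-1) ^ j * (var (Suc j) * q (Suc j)))"
  define D where "D = (\<Sum>j\<in>R. (-1) ^ j *
    (?K (Suc j) * var (Suc j) - var (Suc j) * ?K (Suc j) - q (Suc j) * var (Suc j)))"
  have R: "Suc j \<in> {3..n + 1}" if "j \<in> R" for j using that by (simp add: R_def)
  have qN: "q i \<in> combs {?N} {w. mset w = mset (omit n i)}" if "i \<in> {3..n + 1}" for i
    unfolding q_def using n(1) that by (rule G_plus_K)
  have "Q \<in> combs {?N} {..top}"
    unfolding Q_def
  proof (rule combs_sum)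
    fix j assume "j \<in> R"
    note i = R[OF this]
    have "var (Suc j) * q (Suc j) \<in> combs {?N} {..top}"
      unfolding var_times
    proof (rule framed_in_combs[OF qN[OF i]])
      fix u assume "u \<in> {w. mset w = mset (omit n (Suc j))}"
      then have "Suc j # u \<in> {..top}" using i by (intro left_le) simp_all
      then show "[Suc j] @ u @ [] \<in> {..top}" by simp
    qed
    then show "(-1) ^ j * (var (Suc j) * q (Suc j)) \<in> combs {?N} {..top}"
      unfolding neg_one_power_times by (rule combs_scale)
  qed
  \<comment> \<open>Letters in \<open>top\<close> are distinct, so there is only one multiple of \<open>N_elt\<close> with leading word \<open>top\<close>.\<close>
  from combs_atMost_cases[OF this no_overlap_N]
  consider "Q \<in> combs {?N} {..<top}"
    | c u g v where "g \<in> {?N}" "u @ LM g @ v = top" "Q - framed c u g v \<in> combs {?N} {..<top}"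
    by blast
  then have "\<exists>c. Q - framed c (desc) ?N [] \<in> combs {?N} {..<top}"
  proof cases
    case 1
    then have "Q - framed 0 (desc) ?N [] \<in> combs {?N} {..<top}" by simp
    then show ?thesis ..
  next
    case (2 c u g v)
    then have "desc @ 2 # [1] = u @ 2 # (1 # v)" using w LM_N[where ?'a = 'a] by simp
    from distinct_append_Cons_eq[OF this dist] have "desc = u" "v = []" by simp_all
    then show ?thesis using 2(1,3) by blast
  qed
  then obtain c where c: "Q - framed c (desc) ?N [] \<in> combs {?N} {..<top}" ..
  have D: "D \<in> combs ?B {..<top}"
    unfolding D_def
  proof (rule combs_sum)
    fix j assume "j \<in> R"
    note i = R[OF this]
    obtain m r where o: "omit n (Suc j) = 1 # 2 # m # r" "3 \<le> m" using omit_ge_3[OF n(1) i] by metis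
    have LM_K': "LM (?K (Suc j)) = rev r @ [2, m, 1]" using LM_K(2)[OF i o] .
    have mK: "mset (LM (?K (Suc j))) = mset (omit n (Suc j))" unfolding LM_K' o(1) by simp
    have "Suc j # LM (?K (Suc j)) \<noteq> top"
    proof
      assume "Suc j # LM (?K (Suc j)) = top"
      then have "(Suc j # rev r @ [2]) @ [m, 1] = desc @ [2, 1]" unfolding w LM_K' by simp
      then have "(Suc j # rev r @ [2]) @ [m] = desc @ [2]" using arg_cong[of _ _ butlast] by fastforce
      from arg_cong[OF this, of last] have "m = 2" by simp
      then show False using o(2) by simp
    qed
    then have "Suc j # LM (?K (Suc j)) \<in> {..<top}" using i by (intro left_less mK) simp_all
    then have "var (Suc j) * ?K (Suc j) \<in> combs ?B {..<top}"
      unfolding var_times using B(4)[OF i] by (intro combs_framed) simp_all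
    moreover have "LM (?K (Suc j)) @ [Suc j] \<in> {..<top}" using i by (intro right_less mK) simp_all
    then have "?K (Suc j) * var (Suc j) \<in> combs ?B {..<top}"
      unfolding times_var using B(4)[OF i] by (intro combs_framed) simp_all
    moreover have "q (Suc j) * var (Suc j) \<in> combs {?N} {..<top}"
      unfolding times_var
    proof (rule framed_in_combs[OF qN[OF i]])
      fix u assume "u \<in> {w. mset w = mset (omit n (Suc j))}"
      then have "u @ [Suc j] \<in> {..<top}" using i by (intro right_less) simp_all
      then show "[] @ u @ [Suc j] \<in> {..<top}" by simp
    qed
    then have "q (Suc j) * var (Suc j) \<in> combs ?B {..<top}" by (rule combs_mono) (use B(3) in simp_all)
    ultimately show "(-1) ^ j * (?K (Suc j) * var (Suc j) - var (Suc j) * ?K (Suc j) - q (Suc j) * var (Suc j))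
      \<in> combs ?B {..<top}"
      unfolding neg_one_power_times by (intro combs_scale combs_diff)
  qed
  have "?G 1 * var 1 = var 1 * ?G 1 - (var 2 * ?G 2 - ?G 2 * var 2) + Q + D - framed ?e [] ?N []"
  proof -
    let ?T = "\<lambda>j. (-1) ^ j * (var (Suc j) * ?G (Suc j) - ?G (Suc j) * var (Suc j))"
    have "framed ?e [] ?N [] = sum ?T {..<Suc n}" using commutator_identity[of n \<beta>] n by simp
    also have "{..<Suc n} = insert 0 (insert 1 R)" using n by (auto simp: R_def)
    also have "sum ?T \<dots> = ?T 0 + (?T 1 + sum ?T R)" by (simp add: R_def)
    also have "sum ?T R = Q + D"
      unfolding Q_def D_def sum.distrib[symmetric]
      by (intro sum.cong refl) (simp add: q_def algebra_simps)
    finally show ?thesis by (simp add: numeral_2_eq_2 algebra_simps)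
  qed
  then have "framed 1 [] (?G 1) [1] - framed c (desc) ?N [] =
    (var 1 * ?G 1 - (var 2 * ?G 2 - ?G 2 * var 2)) + (Q - framed c (desc) ?N []) + D - framed ?e [] ?N []"
    by (simp add: times_var)
  also have "\<dots> \<in> combs ?B {..<top}"
  proof -
    have "Q - framed c desc ?N [] \<in> combs ?B {..<top}"
      by (rule combs_mono[OF c]) (use B(3) in simp_all)
    then show ?thesis using x1 x2 x2' D eN by (metis (no_types) combs_add combs_diff)
  qed
  finally have "framed 1 [] (?G 1) [1] - framed c desc ?N [] \<in> combs ?B {..<top}" .
  moreover have "top = [] @ LM (?G 1) @ [1]"
    using LM_G(2)[of n 1 \<beta>] omit_1[of n] n by (simp add: w desc_def)
  ultimately show ?thesis unfolding resolvable_def desc_def by auto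
qed

section \<open>The two generating sets span the same ideal\<close>

lemma carrier_free_algebra:
  "carrier (free_algebra X) = {p. Poly_Mapping.keys p \<subseteq> lists X}"
  by (simp add: free_algebra_def)

lemma ideal_add:
  assumes "ideal J (free_algebra X)" "p \<in> J" "q \<in> J"
  shows "p + q \<in> J"
proof -
  interpret ideal J "free_algebra X" by fact
  show ?thesis
    using additive_subgroup.a_closed[OF additive_subgroup_axioms assms(2,3)] by (simp add: free_algebra_def)
qed

lemma ideal_0:
  assumes "ideal J (free_algebra X)"
  shows "0 \<in> J"
proof -
  interpret ideal J "free_algebra X" by fact
  show ?thesis
    using additive_subgroup.zero_closed[OF additive_subgroup_axioms] by (simp add: free_algebra_def)
qed

lemma ideal_framed:
  assumes J: "ideal J (free_algebra X)" and "p \<in> J" "u \<in> lists X" "v \<in> lists X"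
  shows "framed c u p v \<in> J"
proof -
  interpret ideal J "free_algebra X" by fact
  have u: "Poly_Mapping.single u c \<in> carrier (free_algebra X)"
    and v: "Poly_Mapping.single v 1 \<in> carrier (free_algebra X)"
    using assms by (auto simp: carrier_free_algebra)
  have "Poly_Mapping.single u c * p \<in> J"
    using I_l_closed[OF assms(2) u] by (simp add: free_algebra_def)
  from I_r_closed[OF this v] show ?thesis by (simp add: free_algebra_def framed_def)
qed

lemma ideal_sum:
  assumes "ideal J (free_algebra X)" "\<And>i. i \<in> A \<Longrightarrow> f i \<in> J"
  shows "sum f A \<in> J"
  using assms(2)
  by (induction A rule: infinite_finite_induct) (auto intro: ideal_0 ideal_add assms(1))

lemma ideal_diff:
  assumes "ideal J (free_algebra X)" "p \<in> J" "q \<in> J"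
  shows "p - q \<in> J"
proof -
  have eq: "p - q = p + framed (- 1) [] q []" by (simp add: framed_minus_coeff)
  show ?thesis unfolding eq using assms by (intro ideal_add[of J X] ideal_framed[of J X]) simp_all
qed

text \<open>The restriction on \<open>W\<close> keeps the multiplying words inside the alphabet: they are factors of
  words in \<open>W\<close>.\<close>

lemma combs_subset_ideal:
  assumes J: "ideal J (free_algebra X)" and G: "G \<subseteq> J" and W: "W \<subseteq> lists X"
  shows "combs G W \<subseteq> J"
proof
  fix p assume "p \<in> combs G W"
  then show "p \<in> J"
  proof (induction rule: combs.induct)
    case combs_0
    then show ?case by (rule ideal_0[OF J])
  next
    case (combs_step p g u v c)
    then have "u \<in> lists X" "v \<in> lists X" "g \<in> J" using W G by auto
    then show ?case using combs_step.IH by (intro ideal_add[OF J] ideal_framed[OF J])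
  qed
qed

lemma ideal_combs: "ideal (combs G UNIV \<inter> carrier (free_algebra X)) (free_algebra X)"
proof (rule idealI)
  let ?R = "free_algebra X :: ('a list \<Rightarrow>\<^sub>0 'b) ring"
  interpret R: ring ?R by (rule ring_free_algebra)
  show "ring ?R" by (rule ring_free_algebra)
  show "subgroup (combs G UNIV \<inter> carrier ?R) (add_monoid ?R)"
  proof (rule subgroup.intro)
    fix p q assume pq: "p \<in> combs G UNIV \<inter> carrier ?R" "q \<in> combs G UNIV \<inter> carrier ?R"
    have "p \<oplus>\<^bsub>?R\<^esub> q \<in> carrier ?R" using pq by (intro R.a_closed) auto
    moreover have "p \<oplus>\<^bsub>?R\<^esub> q = p + q" by (simp add: free_algebra_def)
    ultimately show "p \<otimes>\<^bsub>add_monoid ?R\<^esub> q \<in> combs G UNIV \<inter> carrier ?R"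
      using combs_add[of p G UNIV q] pq by simp
  next
    show "\<one>\<^bsub>add_monoid ?R\<^esub> \<in> combs G UNIV \<inter> carrier ?R"
      by (simp add: free_algebra_def combs_0)
  next
    fix p assume p: "p \<in> combs G UNIV \<inter> carrier ?R"
    have "\<ominus>\<^bsub>?R\<^esub> p = - p"
      using p by (intro R.minus_equality) (auto simp: free_algebra_def)
    then show "inv\<^bsub>add_monoid ?R\<^esub> p \<in> combs G UNIV \<inter> carrier ?R"
      using p combs_uminus[of p G UNIV] R.a_inv_closed[of p] by (simp add: a_inv_def)
  qed auto
next
  fix p q :: "'a list \<Rightarrow>\<^sub>0 'b"
  assume pq: "p \<in> combs G UNIV \<inter> carrier (free_algebra X)" "q \<in> carrier (free_algebra X)"
  interpret R: ring "free_algebra X :: ('a list \<Rightarrow>\<^sub>0 'b) ring" by (rule ring_free_algebra)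
  have "q \<otimes>\<^bsub>free_algebra X\<^esub> p = q * p" "p \<otimes>\<^bsub>free_algebra X\<^esub> q = p * q"
    by (simp_all add: free_algebra_def)
  then show "q \<otimes>\<^bsub>free_algebra X\<^esub> p \<in> combs G UNIV \<inter> carrier (free_algebra X)"
    "p \<otimes>\<^bsub>free_algebra X\<^esub> q \<in> combs G UNIV \<inter> carrier (free_algebra X)"
    using pq R.m_closed[of p q] R.m_closed[of q p] combs_left_ideal[of p G q] combs_right_ideal[of p G q]
    by simp_all
qed

lemma keys_G:
  assumes "i \<in> {1..n + 1}" "1 \<le> n"
  shows "Poly_Mapping.keys (G_elt n \<beta> i) \<subseteq> lists {1..n + 1}"
proof -
  have "Poly_Mapping.keys (G_elt n \<beta> i) =
      Poly_Mapping.keys (alt (map var (omit n i)) - G_tail \<beta> i)"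
    unfolding G_elt_eq by (rule keys_scaled) simp
  also have "\<dots> \<subseteq> Poly_Mapping.keys (alt (map var (omit n i)) :: nat list \<Rightarrow>\<^sub>0 'a) \<union>
      Poly_Mapping.keys (G_tail \<beta> i)"
    by (rule keys_diff)
  also have "Poly_Mapping.keys (alt (map var (omit n i)) :: nat list \<Rightarrow>\<^sub>0 'a) \<subseteq> lists {1..n + 1}"
  proof -
    have "Poly_Mapping.keys (alt (map var (omit n i)) :: nat list \<Rightarrow>\<^sub>0 'a) =
        (\<lambda>\<sigma>. permute_list \<sigma> (omit n i)) ` {\<sigma>. \<sigma> permutes {..<length (omit n i)}}"
      unfolding alt_var by (rule keys_signed_words[OF distinct_omit subset_refl])
    moreover have "set (permute_list \<sigma> (omit n i)) \<subseteq> {1..n + 1}"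
      if "\<sigma> permutes {..<length (omit n i)}" for \<sigma>
      unfolding set_permute_list[OF that] set_omit by blast
    ultimately show ?thesis by (auto simp only: in_lists_conv_set)
  qed
  also have "Poly_Mapping.keys (G_tail \<beta> i) \<subseteq> lists {1..n + 1}"
    using keys_G_tail[of \<beta> i] assms(2) by auto
  finally show ?thesis by auto
qed

lemma words_subset_lists:
  "i \<in> {1..n + 1} \<Longrightarrow> {w. mset w = mset (omit n i)} \<subseteq> lists {1..n + 1}"
  using set_omit[of n i] by (auto dest!: mset_eq_setD)

text \<open>Dividing the commutator identity by $\pm\beta$ gives \<open>N_elt\<close>, and from it \<open>G_plus_K\<close> gives
  the \<open>K_elt\<close>.\<close>

lemma G_basis_subset_ideal:
  fixes \<beta> :: "'a::field"
  assumes n: "4 \<le> n" "even n" and "\<beta> \<noteq> 0"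
    and J: "ideal J (free_algebra {1..n + 1})" and G: "G_elt n \<beta> ` {1..n + 1} \<subseteq> J"
  shows "G_basis n \<beta> \<subseteq> J"
proof -
  let ?e = "(-1) ^ (n div 2) * \<beta>"
  have GJ: "G_elt n \<beta> i \<in> J" if "i \<in> {1..n + 1}" for i using G that by blast
  have "(\<Sum>j<Suc n. (-1) ^ j * (var (Suc j) * G_elt n \<beta> (Suc j) - G_elt n \<beta> (Suc j) * var (Suc j))) \<in> J"
    unfolding neg_one_power_times unfolding var_times times_var
    by (intro ideal_sum[OF J] ideal_framed[OF J] ideal_diff[OF J] GJ) auto
  then have "framed ?e [] N_elt [] \<in> J" using commutator_identity[of n \<beta>] n by simp
  then have "framed (inverse ?e) [] (framed ?e [] N_elt []) [] \<in> J"
    by (rule ideal_framed[OF J]) simp_all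
  moreover have "inverse ?e * ?e = 1" using \<open>\<beta> \<noteq> 0\<close> by (intro left_inverse) simp
  ultimately have N: "N_elt \<in> J" unfolding framed_framed by simp
  have K: "K_elt n i \<in> J" if "i \<in> {3..n + 1}" for i
  proof -
    have i: "i \<in> {1..n + 1}" using that by simp
    have "G_elt n \<beta> i + K_elt n i \<in> J"
      using combs_subset_ideal[OF J, of "{N_elt}"] G_plus_K[OF n(1) that] words_subset_lists[OF i] N
      by blast
    from ideal_diff[OF J this GJ[OF i]] show ?thesis by simp
  qed
  show ?thesis using GJ[of 1] GJ[of 2] K N n by (auto simp: G_basis_def)
qed

lemma G_in_combs_G_basis:
  assumes "4 \<le> n" "i \<in> {1..n + 1}"
  shows "G_elt n \<beta> i \<in> combs (G_basis n \<beta>) UNIV"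
proof -
  have self: "g \<in> combs (G_basis n \<beta>) UNIV" if "g \<in> G_basis n \<beta>" for g
    using combs_framed[OF that, of "[]" "[]" UNIV 1] by simp
  consider "i = 1" | "i = 2" | "i \<in> {3..n + 1}" using assms(2) by force
  then show ?thesis
  proof cases
    case 1
    then show ?thesis by (intro self) (simp add: G_basis_def)
  next
    case 2
    then show ?thesis by (intro self) (simp add: G_basis_def)
  next
    case 3
    have "G_elt n \<beta> i + K_elt n i \<in> combs (G_basis n \<beta>) UNIV"
      by (rule combs_mono[OF G_plus_K[OF assms(1) 3]]) (simp_all add: G_basis_def)
    moreover have "K_elt n i \<in> combs (G_basis n \<beta>) UNIV"
      using 3 by (intro self) (simp add: G_basis_def)
    ultimately have "G_elt n \<beta> i + K_elt n i - K_elt n i \<in> combs (G_basis n \<beta>) UNIV"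
      by (rule combs_diff)
    then show ?thesis by simp
  qed
qed

theorem theorem5p7:
  fixes scale :: "'a::field \<Rightarrow> 'v::ab_group_add \<Rightarrow> 'v"
    and bracket :: "'v list \<Rightarrow> 'v"
    and e :: "nat \<Rightarrow> 'v"
    and n :: nat
    and \<beta> :: 'a
  assumes "n \<ge> 4" and "even n" and "\<beta> \<noteq> 0"
    and "n_lie_algebra_L scale n bracket \<beta> e"
  shows "groebner_basis {1..n + 1}
           ({G_elt n \<beta> 1, G_elt n \<beta> 2} \<union> K_elt n ` {3..n + 1} \<union> {N_elt})
           (Idl\<^bsub>free_algebra {1..n + 1}\<^esub> (G_elt n \<beta> ` {1..n + 1}))"
proof -
  let ?R = "free_algebra {1..n + 1} :: (nat list \<Rightarrow>\<^sub>0 'a) ring"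
  let ?S = "G_elt n \<beta> ` {1..n + 1}"
  let ?C = "combs (G_basis n \<beta>) UNIV \<inter> carrier ?R"
  interpret R: ring ?R by (rule ring_free_algebra)
  have S: "?S \<subseteq> carrier ?R"
  proof (rule image_subsetI)
    fix i assume "i \<in> {1..n + 1}"
    then show "G_elt n \<beta> i \<in> carrier ?R"
      using keys_G[of i n \<beta>] assms(1) unfolding carrier_free_algebra by simp
  qed
  have J: "ideal (Idl\<^bsub>?R\<^esub> ?S) ?R" using S by (rule R.genideal_ideal)
  have sub: "G_basis n \<beta> \<subseteq> Idl\<^bsub>?R\<^esub> ?S"
    using assms(1-3) J R.genideal_self[OF S] by (rule G_basis_subset_ideal)
  have "?S \<subseteq> ?C" using S G_in_combs_G_basis[OF assms(1)] by blast
  then have "Idl\<^bsub>?R\<^esub> ?S \<subseteq> ?C" by (rule R.genideal_minimal[OF ideal_combs])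
  moreover have "\<exists>g\<in>G_basis n \<beta>. g \<noteq> 0 \<and> sublist (LM g) (LM f)"
    if "f \<in> combs (G_basis n \<beta>) UNIV" "f \<noteq> 0" for f
    using _ zero_notin_G_basis[OF assms(1)] that
  proof (rule LM_combs_divisible)
    fix g g' :: "nat list \<Rightarrow>\<^sub>0 'a" and u v u' v'
    assume "g \<in> G_basis n \<beta>" "g' \<in> G_basis n \<beta>" "u @ LM g @ v = u' @ LM g' @ v'"
    with zero_notin_G_basis[OF assms(1)] LM_G_basis_sublist[OF assms(1)] _
    show "resolvable (G_basis n \<beta>) u g v u' g' v'"
    proof (rule resolvable_if_overlaps)
      fix g g' a b d
      assume "g \<in> G_basis n \<beta>" "g' \<in> G_basis n \<beta>" "LM g = a @ b" "LM g' = b @ d" "b \<noteq> []" "d \<noteq> []"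
      then show "resolvable (G_basis n \<beta>) [] g d a g' []"
        using G_basis_overlap[OF assms(1)] overlap_resolvable[OF assms(1,2)] by metis
    qed
  qed
  ultimately show ?thesis
    using J sub unfolding groebner_basis_def G_basis_def by blast
qed

end
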